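(* Let $\mathcal A$ be a Banach algebra which is an ideal in its second dual $\mathcal A^{**}$ and has a bounded approximate identity. Let $\mathcal J$ be a closed ideal of $\mathcal A$. Then the following statements are equivalent. (i) $\mathcal J$ is Arens regular. (ii) $i^*(WAP(\mathcal A))^\perp\subseteq\mathcal Z_1(\mathcal J^{**})\cap\mathcal Z_2(\mathcal J^{**})$. (iii) $\mathcal J$ is a weak Riesz ideal in $\mathcal A$. (iv) $i^*(WAP(\mathcal A))^\perp\,\mathcal J^{**}=\{0\}$ and $\mathcal J^{**}\diamond i^*(WAP(\mathcal A))^\perp=\{0\}$.
   Context: For a Banach algebra $\mathcal B$, $a,b\in\mathcal B$, $\varphi\in\mathcal B^*$, $m,n\in\mathcal B^{**}$: $\langle\varphi\cdot a,b\rangle=\langle\varphi,ab\rangle$, $\langle a\cdot\varphi,b\rangle=\langle\varphi,ba\rangle$, $\langle m\cdot\varphi,a\rangle=\langle m,\varphi\cdot a\rangle$, $\langle\varphi\cdot m,a\rangle=\langle m,a\cdot\varphi\rangle$. First Arens product: $\langle mn,\varphi\rangle=\langle m,n\cdot\varphi\rangle$; second Arens product: $\langle m\diamond n,\varphi\rangle=\langle n,\varphi\cdot m\rangle$. $\mathcal B$ is Arens regular if $mn=m\diamond n$ for all $m,n\in\mathcal B^{**}$. Topological centres: $\mathcal Z_1(\mathcal B^{**})=\{m: mn=m\diamond n\ \forall n\in\mathcal B^{**}\}$, $\mathcal Z_2(\mathcal B^{**})=\{m: nm=n\diamond m\ \forall n\in\mathcal B^{**}\}$. $WAP(\mathcal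 A)$ is the space of $\varphi\in\mathcal A^*$ such that $a\mapsto a\cdot\varphi$, $\mathcal A\to\mathcal A^*$, is weakly compact. "Ideal" means two-sided ideal. A bounded approximate identity is a bounded net $(e_\alpha)$ with $ae_\alpha\to a$ and $e_\alpha a\to a$ in norm for all $a$. $i:\mathcal J\to\mathcal A$ is the inclusion, $i^*:\mathcal A^*\to\mathcal J^*$ the restriction map, $\mathcal J^{**}\subseteq\mathcal A^{**}$ via $i^{**}$, and $i^*(WAP(\mathcal A))^\perp=\{r\in\mathcal J^{**}:\langle r,\psi\rangle=0\ \forall\psi\in i^*(WAP(\mathcal A))\}$. $\mathcal J$ is a weak Riesz ideal in $\mathcal A$ if $m\cdot\varphi$ and $\varphi\cdot m$ belong to the norm closure of $i^*(WAP(\mathcal A))$ in $\mathcal J^*$ for all $m\in\mathcal J^{**}$, $\varphi\in\mathcal J^*$. *)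

theory Defs
  imports "HOL-Analysis.Analysis"
begin

text \<open>
  Banach algebras over a scalar field \<open>'k\<close> which is either the reals or the complex numbers:
  both are instances of \<open>{real_normed_field, euclidean_space}\<close>, and up to isomorphism they are the
  only finite-dimensional real normed fields. The algebra need not have a unit.
\<close>

locale banach_algebra = vector_space smul
  for smul :: "'k::{real_normed_field,euclidean_space} \<Rightarrow> 'a::{real_normed_algebra,banach} \<Rightarrow> 'a" +
  assumes smul_of_real: "smul (of_real r) x = r *\<^sub>R x"
    and norm_smul: "norm (smul c x) = norm c * norm x"
    and smul_mult_left: "smul c x * y = smul c (x * y)"
    and smul_mult_right: "x * smul c y = smul c (x * y)"

definition closed_ideal :: "('k::field \<Rightarrow> 'a \<Rightarrow> 'a) \<Rightarrow> 'a::real_normed_algebra set \<Rightarrow> bool" where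
  "closed_ideal smul J \<longleftrightarrow>
     module.subspace smul J \<and> closed J \<and> (\<forall>a. \<forall>x\<in>J. a * x \<in> J \<and> x * a \<in> J)"

text \<open>
  Nets are rendered as functions along a proper filter on an arbitrary index type; for a directed
  index set this is the filter of its tails.
\<close>

definition bounded_approximate_identity ::
    "'i filter \<Rightarrow> ('i \<Rightarrow> 'a::real_normed_algebra) \<Rightarrow> bool" where
  "bounded_approximate_identity F e \<longleftrightarrow> F \<noteq> bot \<and> Bfun e F \<and>
     (\<forall>a. ((\<lambda>i. a * e i) \<longlongrightarrow> a) F \<and> ((\<lambda>i. e i * a) \<longlongrightarrow> a) F)"


text \<open>
  Functionals on a subset \<open>V\<close> of a type are represented by functions that vanish outside \<open>V\<close>, so that
  equality of functionals is equality of functions and restriction to a smaller domain is \<open>zext\<close>.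
\<close>

definition zext :: "'v set \<Rightarrow> ('v \<Rightarrow> 'k::zero) \<Rightarrow> 'v \<Rightarrow> 'k" where
  "zext V f = (\<lambda>x. if x \<in> V then f x else 0)"

definition continuous_dual ::
    "('v \<Rightarrow> 'v \<Rightarrow> 'v) \<Rightarrow> ('k \<Rightarrow> 'v \<Rightarrow> 'v) \<Rightarrow> ('v \<Rightarrow> real) \<Rightarrow> 'v set \<Rightarrow> ('v \<Rightarrow> 'k::real_normed_field) set" where
  "continuous_dual add smul nrm V = {f.
     (\<forall>x\<in>V. \<forall>y\<in>V. f (add x y) = f x + f y) \<and>
     (\<forall>c. \<forall>x\<in>V. f (smul c x) = c * f x) \<and>
     (\<exists>C. \<forall>x\<in>V. norm (f x) \<le> C * nrm x) \<and>
     (\<forall>x. x \<notin> V \<longrightarrow> f x = 0)}"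

text \<open>
  In the following, \<open>B\<close> is a closed subalgebra of the ambient Banach algebra, regarded as a Banach
  algebra in its own right; \<open>B = UNIV\<close> is the ambient algebra itself. As elements of
  \<open>dual smul B\<close> vanish outside \<open>B\<close>, their dual norm is \<^const>\<open>onorm\<close>.
\<close>

definition dual ::
    "('k::real_normed_field \<Rightarrow> 'a \<Rightarrow> 'a) \<Rightarrow> 'a::real_normed_algebra set \<Rightarrow> ('a \<Rightarrow> 'k) set" where
  "dual smul B = continuous_dual (+) smul norm B"

definition bidual ::
    "('k::real_normed_field \<Rightarrow> 'a \<Rightarrow> 'a) \<Rightarrow> 'a::real_normed_algebra set \<Rightarrow> (('a \<Rightarrow> 'k) \<Rightarrow> 'k) set" where
  "bidual smul B =
     continuous_dual (\<lambda>\<phi> \<psi> x. \<phi> x + \<psi> x) (\<lambda>c \<phi> x. c * \<phi> x) onorm (dual smul B)"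

definition dual_closure ::
    "('k::real_normed_field \<Rightarrow> 'a \<Rightarrow> 'a) \<Rightarrow> 'a::real_normed_algebra set \<Rightarrow> ('a \<Rightarrow> 'k) set \<Rightarrow> ('a \<Rightarrow> 'k) set" where
  "dual_closure smul B S =
     {\<psi> \<in> dual smul B. \<forall>\<epsilon>>0. \<exists>\<eta>\<in>S. onorm (\<lambda>x. \<psi> x - \<eta> x) < \<epsilon>}"

definition canonical ::
    "('k::real_normed_field \<Rightarrow> 'a \<Rightarrow> 'a) \<Rightarrow> 'a::real_normed_algebra set \<Rightarrow> 'a \<Rightarrow> ('a \<Rightarrow> 'k) \<Rightarrow> 'k" where
  "canonical smul B a = zext (dual smul B) (\<lambda>\<phi>. \<phi> a)"


text \<open>The module actions \<open>\<phi> \<cdot> a\<close>, \<open>a \<cdot> \<phi>\<close>, \<open>m \<cdot> \<phi>\<close> and \<open>\<phi> \<cdot> m\<close>, in this order.\<close>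

definition dual_ract :: "'a::real_normed_algebra set \<Rightarrow> ('a \<Rightarrow> 'k::real_normed_field) \<Rightarrow> 'a \<Rightarrow> 'a \<Rightarrow> 'k" where
  "dual_ract B \<phi> a = zext B (\<lambda>b. \<phi> (a * b))"

definition dual_lact :: "'a::real_normed_algebra set \<Rightarrow> 'a \<Rightarrow> ('a \<Rightarrow> 'k::real_normed_field) \<Rightarrow> 'a \<Rightarrow> 'k" where
  "dual_lact B a \<phi> = zext B (\<lambda>b. \<phi> (b * a))"

definition bidual_lact ::
    "'a::real_normed_algebra set \<Rightarrow> (('a \<Rightarrow> 'k::real_normed_field) \<Rightarrow> 'k) \<Rightarrow> ('a \<Rightarrow> 'k) \<Rightarrow> 'a \<Rightarrow> 'k" where
  "bidual_lact B m \<phi> = zext B (\<lambda>a. m (dual_ract B \<phi> a))"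

definition bidual_ract ::
    "'a::real_normed_algebra set \<Rightarrow> ('a \<Rightarrow> 'k) \<Rightarrow> (('a \<Rightarrow> 'k::real_normed_field) \<Rightarrow> 'k) \<Rightarrow> 'a \<Rightarrow> 'k" where
  "bidual_ract B \<phi> m = zext B (\<lambda>a. m (dual_lact B a \<phi>))"

definition arens1 ::
    "('k::real_normed_field \<Rightarrow> 'a \<Rightarrow> 'a) \<Rightarrow> 'a::real_normed_algebra set \<Rightarrow>
     (('a \<Rightarrow> 'k) \<Rightarrow> 'k) \<Rightarrow> (('a \<Rightarrow> 'k) \<Rightarrow> 'k) \<Rightarrow> ('a \<Rightarrow> 'k) \<Rightarrow> 'k" where
  "arens1 smul B m n = zext (dual smul B) (\<lambda>\<phi>. m (bidual_lact B n \<phi>))"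

definition arens2 ::
    "('k::real_normed_field \<Rightarrow> 'a \<Rightarrow> 'a) \<Rightarrow> 'a::real_normed_algebra set \<Rightarrow>
     (('a \<Rightarrow> 'k) \<Rightarrow> 'k) \<Rightarrow> (('a \<Rightarrow> 'k) \<Rightarrow> 'k) \<Rightarrow> ('a \<Rightarrow> 'k) \<Rightarrow> 'k" where
  "arens2 smul B m n = zext (dual smul B) (\<lambda>\<phi>. n (bidual_ract B \<phi> m))"

definition arens_regular :: "('k::real_normed_field \<Rightarrow> 'a \<Rightarrow> 'a) \<Rightarrow> 'a::real_normed_algebra set \<Rightarrow> bool" where
  "arens_regular smul B \<longleftrightarrow>
     (\<forall>m\<in>bidual smul B. \<forall>n\<in>bidual smul B. arens1 smul B m n = arens2 smul B m n)"

definition topological_centre1 ::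
    "('k::real_normed_field \<Rightarrow> 'a \<Rightarrow> 'a) \<Rightarrow> 'a::real_normed_algebra set \<Rightarrow> (('a \<Rightarrow> 'k) \<Rightarrow> 'k) set" where
  "topological_centre1 smul B =
     {m \<in> bidual smul B. \<forall>n\<in>bidual smul B. arens1 smul B m n = arens2 smul B m n}"

definition topological_centre2 ::
    "('k::real_normed_field \<Rightarrow> 'a \<Rightarrow> 'a) \<Rightarrow> 'a::real_normed_algebra set \<Rightarrow> (('a \<Rightarrow> 'k) \<Rightarrow> 'k) set" where
  "topological_centre2 smul B =
     {m \<in> bidual smul B. \<forall>n\<in>bidual smul B. arens1 smul B n m = arens2 smul B n m}"

text \<open>
  The canonical image of \<open>B\<close> is always a linear subspace, so only absorption is required. The
  two Arens products agree when one factor lies in that image, so the choice of product is immaterial.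
\<close>

definition ideal_in_bidual :: "('k::real_normed_field \<Rightarrow> 'a \<Rightarrow> 'a) \<Rightarrow> 'a::real_normed_algebra set \<Rightarrow> bool" where
  "ideal_in_bidual smul B \<longleftrightarrow>
     (\<forall>a\<in>B. \<forall>m\<in>bidual smul B.
        arens1 smul B (canonical smul B a) m \<in> canonical smul B ` B \<and>
        arens1 smul B m (canonical smul B a) \<in> canonical smul B ` B)"


definition weak_topology :: "'v set \<Rightarrow> ('v \<Rightarrow> 'k::topological_space) set \<Rightarrow> 'v topology" where
  "weak_topology V F = topology_generated_by {{x \<in> V. f x \<in> U} |f U. f \<in> F \<and> open U}"

text \<open>
  A map into the dual is weakly compact if it sends the closed unit ball to a relatively compact
  set for the topology \<open>\<sigma>(B\<^sup>*, B\<^sup>*\<^sup>*)\<close>.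
\<close>

definition weakly_compact_into_dual ::
    "('k::real_normed_field \<Rightarrow> 'a \<Rightarrow> 'a) \<Rightarrow> 'a::real_normed_algebra set \<Rightarrow> ('a \<Rightarrow> 'a \<Rightarrow> 'k) \<Rightarrow> bool" where
  "weakly_compact_into_dual smul B T \<longleftrightarrow>
     (let \<sigma> = weak_topology (dual smul B) (bidual smul B)
      in compactin \<sigma> (\<sigma> closure_of (T ` {a \<in> B. norm a \<le> 1})))"

definition WAP :: "('k::real_normed_field \<Rightarrow> 'a \<Rightarrow> 'a) \<Rightarrow> 'a::real_normed_algebra set \<Rightarrow> ('a \<Rightarrow> 'k) set" where
  "WAP smul B =
     {\<phi> \<in> dual smul B. weakly_compact_into_dual smul B (\<lambda>a. dual_lact B a \<phi>)}"


text \<open>\<open>i\<^sup>*(WAP(A))\<close> for the inclusion \<open>i\<close> of \<open>J\<close> into the ambient algebra \<open>A\<close>.\<close>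

definition WAP_restrict ::
    "('k::real_normed_field \<Rightarrow> 'a \<Rightarrow> 'a) \<Rightarrow> 'a::real_normed_algebra set \<Rightarrow> ('a \<Rightarrow> 'k) set" where
  "WAP_restrict smul J = zext J ` WAP smul UNIV"

definition WAP_perp ::
    "('k::real_normed_field \<Rightarrow> 'a \<Rightarrow> 'a) \<Rightarrow> 'a::real_normed_algebra set \<Rightarrow> (('a \<Rightarrow> 'k) \<Rightarrow> 'k) set" where
  "WAP_perp smul J = {r \<in> bidual smul J. \<forall>\<psi>\<in>WAP_restrict smul J. r \<psi> = 0}"

definition weak_Riesz_ideal :: "('k::real_normed_field \<Rightarrow> 'a \<Rightarrow> 'a) \<Rightarrow> 'a::real_normed_algebra set \<Rightarrow> bool" where
  "weak_Riesz_ideal smul J \<longleftrightarrow>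
     (\<forall>m\<in>bidual smul J. \<forall>\<phi>\<in>dual smul J.
        bidual_lact J m \<phi> \<in> dual_closure smul J (WAP_restrict smul J) \<and>
        bidual_ract J \<phi> m \<in> dual_closure smul J (WAP_restrict smul J))"

end

theory Submission
  imports Defs "HOL-Library.Function_Algebras"
begin

text \<open>
  The two Arens products of \<open>m\<close> and \<open>n\<close> at \<open>\<phi>\<close> are \<open>m(n \<cdot> \<phi>)\<close> and \<open>n(\<phi> \<cdot> m)\<close>. Since the algebra is an
  ideal in its bidual, every \<open>a \<cdot> \<phi>\<close> and \<open>\<phi> \<cdot> a\<close> is weakly almost periodic, so \<open>r \<cdot> \<phi> = \<phi> \<cdot> r = 0\<close> for \<open>r\<close>
  in the annihilator of \<open>i\<^sup>*(WAP(A))\<close>. Hence (ii) and (iv) both say that every such \<open>r\<close> annihilates all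
  \<open>m \<cdot> \<phi>\<close> and \<open>\<phi> \<cdot> m\<close>; by the Hahn--Banach theorem so does (iii), and (i) implies it.
  For the converse, \<open>m(e\<^sub>\<alpha> \<cdot> (n \<cdot> \<phi>)) = n((\<phi> \<cdot> m) \<cdot> e\<^sub>\<alpha>)\<close> always holds, because \<open>e\<^sub>\<alpha> n\<close> lies
  in the ideal itself. If \<open>\<psi>\<close> is in the closure of \<open>i\<^sup>*(WAP(A))\<close>, then \<open>e\<^sub>\<alpha> \<cdot> \<psi>\<close> and \<open>\<psi> \<cdot> e\<^sub>\<alpha>\<close> tend
  weakly to \<open>\<psi>\<close>: this is clear for \<open>\<psi> = a \<cdot> \<chi>\<close>, and such functionals are norm dense in
  \<open>i\<^sup>*(WAP(A))\<close>. So (iii) gives \<open>m(n \<cdot> \<phi>) = n(\<phi> \<cdot> m)\<close> in the limit.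
\<close>

section \<open>The Hahn--Banach theorem\<close>

text \<open>The tool for subadditivity of functionals defined as infima: the two infima are taken
  one after the other, with the other variable held fixed.\<close>

lemma cINF_add_greatest:
  fixes f :: "'a \<Rightarrow> real" and g :: "'b \<Rightarrow> real"
  assumes "A \<noteq> {}" "B \<noteq> {}" "\<And>a b. a \<in> A \<Longrightarrow> b \<in> B \<Longrightarrow> z \<le> f a + g b"
  shows "z \<le> (INF a\<in>A. f a) + (INF b\<in>B. g b)"
proof -
  have "z - g b \<le> (INF a\<in>A. f a)" if "b \<in> B" for b
    using assms that by (intro cINF_greatest) (auto simp: algebra_simps)
  then have "z - (INF a\<in>A. f a) \<le> (INF b\<in>B. g b)"
    using assms(2) by (intro cINF_greatest) (auto simp: algebra_simps)
  then show ?thesis by simp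
qed

section \<open>Sublinear functionals and their minimal elements\<close>

locale normed_scalar_space = vector_space scale
  for scale :: "'k::{real_normed_field,euclidean_space} \<Rightarrow> 'v::ab_group_add \<Rightarrow> 'v"
begin

definition sublinear :: "('v \<Rightarrow> real) \<Rightarrow> bool" where
  "sublinear q \<longleftrightarrow> (\<forall>x y. q (x + y) \<le> q x + q y) \<and> (\<forall>t\<ge>0. \<forall>x. q (scale (of_real t) x) = t * q x)"

text \<open>Applying the assumed inequality with factor \<open>inverse t\<close> to the vector
  \<open>t x\<close> gives the reverse inequality, hence homogeneity.\<close>

lemma sublinearI:
  assumes add: "\<And>x y. q (x + y) \<le> q x + q y"
    and zero: "q 0 = 0"
    and le: "\<And>t x. t > 0 \<Longrightarrow> q (scale (of_real t) x) \<le> t * q x"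
  shows "sublinear q"
proof -
  have "q (scale (of_real t) x) = t * q x" if "t \<ge> 0" for t x
  proof (cases "t = 0")
    case True
    then show ?thesis using zero by simp
  next
    case False
    then have t: "t > 0" using that by simp
    have "q (scale (of_real (inverse t)) (scale (of_real t) x)) \<le> inverse t * q (scale (of_real t) x)"
      using t by (intro le) simp
    also have "scale (of_real (inverse t)) (scale (of_real t) x) = x"
      using t by (simp flip: of_real_mult)
    finally have "t * q x \<le> q (scale (of_real t) x)"
      using t by (simp add: field_simps)
    then show ?thesis using le[OF t] by (simp add: antisym)
  qed
  then show ?thesis using add by (auto simp: sublinear_def)
qed

lemma sublinear_add: "sublinear q \<Longrightarrow> q (x + y) \<le> q x + q y"
  and sublinear_scale: "sublinear q \<Longrightarrow> t \<ge> 0 \<Longrightarrow> q (scale (of_real t) x) = t * q x"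
  by (auto simp: sublinear_def)

lemma sublinear_zero: "sublinear q \<Longrightarrow> q 0 = 0"
  using sublinear_scale[of q 0 0] by simp

lemma sublinear_lower: "sublinear q \<Longrightarrow> - q (- x) \<le> q x"
  using sublinear_add[of q x "- x"] sublinear_zero[of q] by simp

text \<open>A linear functional is found as a minimal sublinear functional below \<open>p\<close>.\<close>

lemma sublinear_minimal:
  assumes p: "sublinear p"
  obtains q where "sublinear q" "q \<le> p" "\<And>q'. sublinear q' \<Longrightarrow> q' \<le> q \<Longrightarrow> q' = q"
proof -
  define A where "A = {q. sublinear q \<and> q \<le> p}"
  \<comment> \<open>The order is reversed, so that the maximal element supplied by Zorn's lemma is a
    minimal functional.\<close>
  have po: "partial_order_on A (relation_of (\<lambda>f g. g \<le> f) A)"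
    by (rule partial_order_on_relation_ofI) auto
  have "\<exists>m\<in>A. \<forall>a\<in>A. a \<le> m \<longrightarrow> a = m"
  proof (rule predicate_Zorn[OF po])
    fix C assume "C \<in> Chains (relation_of (\<lambda>f g. g \<le> f) A)"
    then have CA: "C \<subseteq> A" and ch: "\<And>f g. f \<in> C \<Longrightarrow> g \<in> C \<Longrightarrow> f \<le> g \<or> g \<le> f"
      by (auto simp: Chains_def relation_of_def)
    show "\<exists>u\<in>A. \<forall>a\<in>C. u \<le> a"
    proof (cases "C = {}")
      case True
      then show ?thesis using p by (auto simp: A_def)
    next
      case False
      define u where "u x = (INF c\<in>C. c x)" for x
      have sub: "sublinear c" "c \<le> p" if "c \<in> C" for c
        using CA that by (auto simp: A_def)
      \<comment> \<open>All members lie below \<open>p\<close>, so \<open>- p (- x)\<close> is a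
        common lower bound and the pointwise infimum of the chain is meaningful.\<close>
      have bd: "bdd_below ((\<lambda>c. c x) ` C)" for x
      proof (rule bdd_belowI2)
        fix c assume c: "c \<in> C"
        show "- p (- x) \<le> c x"
          using sublinear_lower[OF sub(1)[OF c], of x] sub(2)[OF c] by (smt (verit) le_fun_def)
      qed
      have ule: "u x \<le> c x" if "c \<in> C" for c x
        unfolding u_def using that bd by (auto intro: cINF_lower)
      have "sublinear u"
      proof (rule sublinearI)
        fix x y
        have "u (x + y) \<le> (INF c\<in>C. c x) + (INF c\<in>C. c y)"
        proof (rule cINF_add_greatest[OF False False])
          fix a b assume ab: "a \<in> C" "b \<in> C"
          \<comment> \<open>The smaller of the two functionals is subadditive and bounds both
            summands from below.\<close>
          consider "a \<le> b" | "b \<le> a" using ch ab by blast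
          then show "u (x + y) \<le> a x + b y"
          proof cases
            case 1
            then show ?thesis
              using ule[OF ab(1), of "x+y"] sublinear_add[OF sub(1)[OF ab(1)], of x y]
              by (smt (verit) le_fun_def)
          next
            case 2
            then show ?thesis
              using ule[OF ab(2), of "x+y"] sublinear_add[OF sub(1)[OF ab(2)], of x y]
              by (smt (verit) le_fun_def)
          qed
        qed
        then show "u (x + y) \<le> u x + u y" by (simp add: u_def)
      next
        have "(INF c\<in>C. c 0) = (INF c\<in>C. (0::real))"
          using sub(1) sublinear_zero by (intro INF_cong) auto
        then show "u 0 = 0" using False by (simp add: u_def)
      next
        fix t :: real and x assume t: "t > 0"
        have "inverse t * u (scale (of_real t) x) \<le> (INF c\<in>C. c x)"
        proof (rule cINF_greatest[OF False])
          fix c assume c: "c \<in> C"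
          show "inverse t * u (scale (of_real t) x) \<le> c x"
            using ule[OF c, of "scale (of_real t) x"] sublinear_scale[OF sub(1)[OF c], of t x] t
            by (simp add: field_simps)
        qed
        then show "u (scale (of_real t) x) \<le> t * u x"
          using t by (simp add: u_def field_simps)
      qed
      moreover have "u \<le> p"
        using False ule sub(2) by (meson equals0I le_fun_def order_trans)
      ultimately show ?thesis using ule by (auto simp: A_def le_fun_def)
    qed
  qed
  then obtain m where "m \<in> A" "\<forall>a\<in>A. a \<le> m \<longrightarrow> a = m" by blast
  then show thesis using that[of m] by (auto simp: A_def dest: order_trans)
qed

text \<open>A pair \<open>(c, g)\<close> encodes the demand that the functional to be found be at
  least \<open>g\<close> at \<open>c\<close>. Demands may be added and rescaled by positive
  reals.\<close>

definition convex_cone :: "('v \<times> real) set \<Rightarrow> bool" where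
  "convex_cone \<Gamma> \<longleftrightarrow> (0, 0) \<in> \<Gamma> \<and> (\<forall>c g d h. (c, g) \<in> \<Gamma> \<longrightarrow> (d, h) \<in> \<Gamma> \<longrightarrow> (c + d, g + h) \<in> \<Gamma>) \<and>
     (\<forall>t c g. t > 0 \<longrightarrow> (c, g) \<in> \<Gamma> \<longrightarrow> (scale (of_real t) c, t * g) \<in> \<Gamma>)"

text \<open>The functional \<open>q x\<close> is the infimum of \<open>p (x + c) - g\<close> over
  the cone. A linear functional below \<open>q\<close> meets every demand, because its value at
  \<open>- c\<close> is at most \<open>- g\<close>.\<close>

lemma sublinear_cone:
  assumes p: "sublinear p" and \<Gamma>: "convex_cone \<Gamma>" and le: "\<And>c g. (c, g) \<in> \<Gamma> \<Longrightarrow> g \<le> p c"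
  obtains q where "sublinear q" "q \<le> p" "\<And>c g. (c, g) \<in> \<Gamma> \<Longrightarrow> q (- c) \<le> - g"
proof -
  define q where "q x = (INF (c, g)\<in>\<Gamma>. p (x + c) - g)" for x
  have ne: "\<Gamma> \<noteq> {}" using \<Gamma> by (auto simp: convex_cone_def)
  have bd: "bdd_below ((\<lambda>(c, g). p (x + c) - g) ` \<Gamma>)" for x
  proof (rule bdd_belowI2)
    fix cg assume "cg \<in> \<Gamma>"
    moreover obtain c g where "cg = (c, g)" by force
    ultimately show "- p (- x) \<le> (case cg of (c, g) \<Rightarrow> p (x + c) - g)"
      using le[of c g] sublinear_add[OF p, of "x + c" "- x"] by simp
  qed
  have qle: "q x \<le> p (x + c) - g" if "(c, g) \<in> \<Gamma>" for x c g
    unfolding q_def using cINF_lower[OF bd that] by simp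
  have z: "(0, 0) \<in> \<Gamma>" using \<Gamma> by (simp add: convex_cone_def)
  have "sublinear q"
  proof (rule sublinearI)
    fix x y
    have "q (x + y) \<le> (INF (c, g)\<in>\<Gamma>. p (x + c) - g) + (INF (c, g)\<in>\<Gamma>. p (y + c) - g)"
    proof (rule cINF_add_greatest[OF ne ne])
      fix a b assume ab: "a \<in> \<Gamma>" "b \<in> \<Gamma>"
      obtain c g d h where cg: "a = (c, g)" "b = (d, h)" by fastforce
      have "q (x + y) \<le> p (x + y + (c + d)) - (g + h)"
        using \<Gamma> ab cg by (intro qle) (auto simp: convex_cone_def)
      also have "p (x + y + (c + d)) \<le> p (x + c) + p (y + d)"
        using sublinear_add[OF p, of "x + c" "y + d"] by (simp add: algebra_simps)
      finally show "q (x + y) \<le> (case a of (c, g) \<Rightarrow> p (x + c) - g) + (case b of (c, g) \<Rightarrow> p (y + c) - g)"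
        by (simp add: cg)
    qed
    then show "q (x + y) \<le> q x + q y" by (simp add: q_def)
  next
    have "0 \<le> q 0"
      unfolding q_def using le by (intro cINF_greatest[OF ne]) auto
    then show "q 0 = 0" using qle[OF z, of 0] sublinear_zero[OF p] by simp
  next
    fix t :: real and x assume t: "t > 0"
    have "inverse t * q (scale (of_real t) x) \<le> (INF (c, g)\<in>\<Gamma>. p (x + c) - g)"
    proof (rule cINF_greatest[OF ne])
      fix cg assume "cg \<in> \<Gamma>"
      moreover obtain c g where cg: "cg = (c, g)" by force
      ultimately have "(scale (of_real t) c, t * g) \<in> \<Gamma>"
        using \<Gamma> t by (simp add: convex_cone_def)
      from qle[OF this, of "scale (of_real t) x"]
      have "q (scale (of_real t) x) \<le> t * (p (x + c) - g)"
        using sublinear_scale[OF p, of t "x + c"] t by (simp add: algebra_simps scale_right_distrib)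
      then show "inverse t * q (scale (of_real t) x) \<le> (case cg of (c, g) \<Rightarrow> p (x + c) - g)"
        using t cg by (simp add: field_simps)
    qed
    then show "q (scale (of_real t) x) \<le> t * q x"
      using t by (simp add: q_def field_simps)
  qed
  moreover have "q \<le> p" using qle[OF z] by (simp add: le_fun_def)
  moreover have "q (- c) \<le> - g" if "(c, g) \<in> \<Gamma>" for c g
    using qle[OF that, of "- c"] sublinear_zero[OF p] by simp
  ultimately show thesis using that by blast
qed

text \<open>The cone spanned by \<open>(y, q y)\<close> gives a sublinear functional below
  \<open>q\<close> whose value at \<open>- y\<close> is at most \<open>- q y\<close>. By minimality
  it is \<open>q\<close> itself, so \<open>q\<close> is odd, and an odd sublinear functional is
  real-linear.\<close>

lemma minimal_sublinear_additive:
  assumes q: "sublinear q" and min: "\<And>q'. sublinear q' \<Longrightarrow> q' \<le> q \<Longrightarrow> q' = q"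
  shows "q (x + y) = q x + q y" "q (scale (of_real t) x) = t * q x"
proof -
  have neg: "q (- y) = - q y" for y
  proof -
    let ?\<Gamma> = "{(scale (of_real t) y, t * q y) |t. t \<ge> 0}"
    have cone: "convex_cone ?\<Gamma>"
      unfolding convex_cone_def
    proof (intro conjI allI impI)
      show "(0, 0) \<in> ?\<Gamma>"
        using scale_zero_left[of y] by (auto intro!: exI[of _ 0])
      fix c g d h assume "(c, g) \<in> ?\<Gamma>" "(d, h) \<in> ?\<Gamma>"
      then obtain s t where "c = scale (of_real s) y" "g = s * q y" "s \<ge> 0"
          "d = scale (of_real t) y" "h = t * q y" "t \<ge> 0" by auto
      then show "(c + d, g + h) \<in> ?\<Gamma>"
        by (auto intro!: exI[of _ "s + t"] simp: algebra_simps scale_left_distrib)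
    next
      fix t :: real and c g assume "t > 0" "(c, g) \<in> ?\<Gamma>"
      then obtain s where "c = scale (of_real s) y" "g = s * q y" "s \<ge> 0" by auto
      then show "(scale (of_real t) c, t * g) \<in> ?\<Gamma>"
        using \<open>t > 0\<close> by (auto intro!: exI[of _ "t * s"])
    qed
    have "g \<le> q c" if "(c, g) \<in> ?\<Gamma>" for c g
      using that sublinear_scale[OF q] by auto
    from sublinear_cone[OF q cone this]
    obtain q' where q': "sublinear q'" "q' \<le> q" "\<And>c g. (c, g) \<in> ?\<Gamma> \<Longrightarrow> q' (- c) \<le> - g"
      by blast
    have "(y, q y) \<in> ?\<Gamma>" by (auto intro!: exI[of _ 1])
    from q'(3)[OF this] have "q (- y) \<le> - q y" using min[OF q'(1,2)] by simp
    then show ?thesis using sublinear_lower[OF q, of y] sublinear_lower[OF q, of "- y"] by simp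
  qed
  show "q (x + y) = q x + q y"
    using sublinear_add[OF q, of x y] sublinear_add[OF q, of "x + y" "- y"] neg[of y] by simp
  show "q (scale (of_real t) x) = t * q x"
  proof (cases "t \<ge> 0")
    case False
    then have "q (scale (of_real (- t)) x) = - t * q x" by (intro sublinear_scale[OF q]) simp
    then show ?thesis using neg[of "scale (of_real t) x"] by simp
  qed (rule sublinear_scale[OF q])
qed

section \<open>Passing from real parts to real or complex values\<close>

text \<open>
  The form \<open>inner (c * d) 1\<close> is nondegenerate, so a real-linear functional is the
  \<open>inner _ 1\<close>-component of a unique linear one; this handles real and complex scalars at once.
\<close>

lemma inner_one_represents:
  fixes h :: "'k \<Rightarrow> real"
  assumes h: "linear h"
  obtains d where "\<And>c. h c = inner (c * d) 1"
proof -
  \<comment> \<open>\<open>?L d\<close> is the Riesz vector of the functional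
    \<open>\<lambda>c. inner (c * d) 1\<close>. Nondegeneracy makes \<open>?L\<close> injective,
    hence surjective in finite dimension.\<close>
  let ?L = "\<lambda>d::'k. \<Sum>b\<in>Basis. inner (b * d) 1 *\<^sub>R b"
  have L: "inner c (?L d) = inner (c * d) 1" for c d
  proof -
    have "inner (c * d) 1 = inner ((\<Sum>b\<in>Basis. inner c b *\<^sub>R b) * d) 1"
      by (simp add: euclidean_representation)
    also have "\<dots> = (\<Sum>b\<in>Basis. inner c b * inner (b * d) 1)"
      by (simp add: sum_distrib_right inner_sum_left)
    finally show ?thesis by (simp add: inner_sum_right mult.commute)
  qed
  have lin: "linear ?L"
    by (rule linearI) (simp_all add: algebra_simps inner_add_left scaleR_add_left sum.distrib
        scaleR_sum_right inner_scaleR_left)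
  have "d = 0" if "?L d = 0" for d
  proof (rule ccontr)
    assume "d \<noteq> 0"
    then have "inner (inverse d * d) (1::'k) = 1" by (simp add: dot_square_norm)
    then show False using L[of "inverse d" d] that by simp
  qed
  then have "inj ?L" using linear_injective_0[OF lin] by blast
  then have "surj ?L" using linear_injective_imp_surjective[OF lin] by blast
  from surjD[OF this, of "\<Sum>b\<in>Basis. h b *\<^sub>R b"]
  obtain d where d: "?L d = (\<Sum>b\<in>Basis. h b *\<^sub>R b)" by auto
  have "h c = inner (c * d) 1" for c
  proof -
    have "h c = h (\<Sum>b\<in>Basis. inner c b *\<^sub>R b)" by (simp add: euclidean_representation)
    also have "\<dots> = (\<Sum>b\<in>Basis. inner c b * h b)"
      using h by (simp add: linear_sum linear_scale)
    also have "\<dots> = inner c (?L d)" by (simp add: d inner_sum_right mult.commute)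
    finally show ?thesis by (simp add: L)
  qed
  then show thesis using that by blast
qed

lemma inner_mult_one_eqD:
  fixes x y :: 'k
  assumes "\<And>c. inner (c * x) 1 = inner (c * y) 1"
  shows "x = y"
proof (rule ccontr)
  assume "x \<noteq> y"
  then have "inner (inverse (x - y) * (x - y)) (1::'k) = 1" by (simp add: dot_square_norm)
  moreover have "inner (inverse (x - y) * (x - y)) (1::'k) = 0"
    using assms[of "inverse (x - y)"] by (simp only: right_diff_distrib inner_diff_left)
  ultimately show False by simp
qed

section \<open>Extension and separation under a seminorm on a subspace\<close>

text \<open>
  Extension uses the cone that is the graph of the functional on the subspace, separation of \<open>v\<close> from
  \<open>S\<close> at distance \<open>d\<close> uses the cone of the pairs \<open>(s + t v, t d)\<close> with \<open>t \<ge> 0\<close>.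
\<close>

lemma hahn_banach_cone:
  assumes V: "subspace V"
    and p_add: "\<And>x y. x \<in> V \<Longrightarrow> y \<in> V \<Longrightarrow> p (x + y) \<le> p x + p y"
    and p_scale: "\<And>c x. x \<in> V \<Longrightarrow> p (scale c x) \<le> norm c * p x"
    and \<Gamma>: "convex_cone \<Gamma>" and \<Gamma>V: "\<And>c g. (c, g) \<in> \<Gamma> \<Longrightarrow> c \<in> V \<and> g \<le> p c"
  obtains f where "\<And>x y. x \<in> V \<Longrightarrow> y \<in> V \<Longrightarrow> f (x + y) = f x + f y"
    "\<And>c x. x \<in> V \<Longrightarrow> f (scale c x) = c * f x" "\<And>x. x \<in> V \<Longrightarrow> norm (f x) \<le> p x"
    "\<And>c g. (c, g) \<in> \<Gamma> \<Longrightarrow> g \<le> inner (f c) 1"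
proof -
  interpret vector_space_pair scale scale by unfold_locales
  \<comment> \<open>A linear projection onto \<open>V\<close>: since \<open>p\<close> behaves as a
    seminorm only on \<open>V\<close>, it is replaced by \<open>p \<circ> \<pi>\<close>, which is
    sublinear on the whole type.\<close>
  have "\<exists>\<pi>. \<pi> ` UNIV \<subseteq> V \<and> Vector_Spaces.linear scale scale \<pi> \<and> (\<forall>v\<in>V. \<pi> (id v) = v)"
    by (rule linear_exists_left_inverse_on[OF _ V]) (unfold_locales, simp_all)
  then obtain \<pi> where \<pi>V: "\<And>x. \<pi> x \<in> V" and lin: "Vector_Spaces.linear scale scale \<pi>"
    and \<pi>id: "\<And>v. v \<in> V \<Longrightarrow> \<pi> v = v" by auto
  interpret \<pi>: Vector_Spaces.linear scale scale \<pi> by (rule lin)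
  have p0: "p 0 = 0"
    using p_add[of 0 0] p_scale[of 0 0] subspace_0[OF V] by auto
  have "sublinear (p \<circ> \<pi>)"
  proof (rule sublinearI)
    show "(p \<circ> \<pi>) (x + y) \<le> (p \<circ> \<pi>) x + (p \<circ> \<pi>) y" for x y
      using p_add \<pi>V by (simp add: \<pi>.add)
    show "(p \<circ> \<pi>) (scale (of_real t) x) \<le> t * (p \<circ> \<pi>) x" if "t > 0" for t x
      using p_scale[OF \<pi>V, of "of_real t" x] that by (simp add: \<pi>.scale)
  qed (simp add: p0 \<pi>.zero)
  from sublinear_cone[OF this \<Gamma>] obtain q1 where q1: "sublinear q1" "q1 \<le> p \<circ> \<pi>"
      "\<And>c g. (c, g) \<in> \<Gamma> \<Longrightarrow> q1 (- c) \<le> - g"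
    using \<Gamma>V \<pi>id by auto
  from sublinear_minimal[OF q1(1)] obtain q where q: "sublinear q" "q \<le> q1"
    "\<And>q'. sublinear q' \<Longrightarrow> q' \<le> q \<Longrightarrow> q' = q" by blast
  note q_add = minimal_sublinear_additive(1)[OF q(1,3)]
   and q_scale = minimal_sublinear_additive(2)[OF q(1,3)]
  have qp: "q x \<le> p x" if "x \<in> V" for x
    using q(2) q1(2) \<pi>id[OF that] by (metis comp_apply le_fun_def order_trans)
  have "\<exists>d. \<forall>c. q (scale c x) = inner (c * d) 1" for x
  proof -
    have "linear (\<lambda>c. q (scale c x))"
      by (rule linearI)
        (simp_all add: scale_left_distrib q_add scaleR_conv_of_real q_scale flip: scale_scale)
    from inner_one_represents[OF this] show ?thesis by blast
  qed
  then obtain f where f: "\<And>x c. q (scale c x) = inner (c * f x) 1" by metis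
  show thesis
  proof
    show "f (x + y) = f x + f y" for x y
      by (rule inner_mult_one_eqD) (simp add: scale_right_distrib q_add distrib_left inner_add_left flip: f)
    show "f (scale c x) = c * f x" for c x
      by (rule inner_mult_one_eqD) (simp add: mult.assoc[symmetric] flip: f)
    show "norm (f x) \<le> p x" if x: "x \<in> V" for x
    proof (cases "f x = 0")
      case True
      have "0 \<le> p x"
        using p_add[OF x subspace_neg[OF V x]] p_scale[OF x, of "- 1"] p0 by simp
      then show ?thesis using True by simp
    next
      case False
      \<comment> \<open>Multiplying \<open>x\<close> by \<open>inverse (f x)\<close> moves the value
        of \<open>f\<close> to \<open>1\<close>, so the bound on \<open>q\<close> becomes a bound on
        the full norm of \<open>f x\<close>.\<close>
      have "1 = q (scale (inverse (f x)) x)"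
        unfolding f using False by (simp add: dot_square_norm)
      also have "\<dots> \<le> norm (inverse (f x)) * p x"
        using qp[OF subspace_scale[OF V x]] p_scale[OF x] by (rule order_trans)
      finally have "norm (f x) * 1 \<le> norm (f x) * (inverse (norm (f x)) * p x)"
        by (intro mult_left_mono) (simp_all add: norm_inverse)
      also have "\<dots> = p x" using False by simp
      finally show ?thesis by simp
    qed
    show "g \<le> inner (f c) 1" if "(c, g) \<in> \<Gamma>" for c g
    proof -
      have "q (- c) \<le> - g" using q1(3)[OF that] q(2) by (metis le_fun_def order_trans)
      moreover have "q (- c) = - inner (f c) 1" using f[of "- 1" c] by simp
      ultimately show ?thesis by simp
    qed
  qed
qed

lemma hahn_banach_extension:
  assumes V: "subspace V" and S: "subspace S" "S \<subseteq> V"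
    and p_add: "\<And>x y. x \<in> V \<Longrightarrow> y \<in> V \<Longrightarrow> p (x + y) \<le> p x + p y"
    and p_scale: "\<And>c x. x \<in> V \<Longrightarrow> p (scale c x) \<le> norm c * p x"
    and f_add: "\<And>x y. x \<in> S \<Longrightarrow> y \<in> S \<Longrightarrow> f (x + y) = f x + f y"
    and f_scale: "\<And>c x. x \<in> S \<Longrightarrow> f (scale c x) = c * f x"
    and f_le: "\<And>x. x \<in> S \<Longrightarrow> norm (f x) \<le> p x"
  obtains g where "\<And>x y. x \<in> V \<Longrightarrow> y \<in> V \<Longrightarrow> g (x + y) = g x + g y"
    "\<And>c x. x \<in> V \<Longrightarrow> g (scale c x) = c * g x" "\<And>x. x \<in> V \<Longrightarrow> norm (g x) \<le> p x"
    "\<And>x. x \<in> S \<Longrightarrow> g x = f x"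
proof -
  let ?\<Gamma> = "(\<lambda>x. (x, inner (f x) 1)) ` S"
  have cone: "convex_cone ?\<Gamma>"
    unfolding convex_cone_def
  proof (intro conjI allI impI)
    show "(0, 0) \<in> ?\<Gamma>"
      using subspace_0[OF S(1)] f_scale[of 0 0] by (auto intro!: image_eqI[of _ _ 0])
    show "(c + d, g + h) \<in> ?\<Gamma>" if "(c, g) \<in> ?\<Gamma>" "(d, h) \<in> ?\<Gamma>" for c g d h
      using that subspace_add[OF S(1)] f_add by (auto simp: image_iff inner_add_left)
    show "(scale (of_real t) c, t * g) \<in> ?\<Gamma>" if "0 < t" "(c, g) \<in> ?\<Gamma>" for t c g
      using that subspace_scale[OF S(1)] f_scale
      by (auto simp: image_iff simp flip: scaleR_conv_of_real)
  qed
  have le: "c \<in> V \<and> g \<le> p c" if "(c, g) \<in> ?\<Gamma>" for c g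
  proof -
    have c: "c \<in> S" "g = inner (f c) 1" using that by auto
    have "inner (f c) 1 \<le> norm (f c)" using norm_cauchy_schwarz[of "f c" 1] by simp
    then show ?thesis using c f_le[of c] S(2) by auto
  qed
  obtain g where g: "\<And>x y. x \<in> V \<Longrightarrow> y \<in> V \<Longrightarrow> g (x + y) = g x + g y"
    "\<And>c x. x \<in> V \<Longrightarrow> g (scale c x) = c * g x" "\<And>x. x \<in> V \<Longrightarrow> norm (g x) \<le> p x"
    "\<And>c h. (c, h) \<in> ?\<Gamma> \<Longrightarrow> h \<le> inner (g c) 1"
    using hahn_banach_cone[OF V p_add p_scale cone le] by blast
  have ge: "inner (f x) 1 \<le> inner (g x) 1" if "x \<in> S" for x
    using g(4) that by blast
  have "g x = f x" if x: "x \<in> S" for x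
  proof (rule inner_mult_one_eqD)
    fix c
    \<comment> \<open>The cone yields only one inequality. Using it for both \<open>c\<close> and
      \<open>- c\<close> turns it into an equality.\<close>
    have "inner (c * f x) 1 \<le> inner (c * g x) 1" for c
      using ge[OF subspace_scale[OF S(1) x, of c]] g(2)[of x c] f_scale[OF x, of c] x S(2) by auto
    from this[of c] this[of "- c"] show "inner (c * g x) 1 = inner (c * f x) 1" by simp
  qed
  then show thesis using that g(1-3) by blast
qed

lemma hahn_banach_separation:
  assumes V: "subspace V" and S: "subspace S" "S \<subseteq> V"
    and p_add: "\<And>x y. x \<in> V \<Longrightarrow> y \<in> V \<Longrightarrow> p (x + y) \<le> p x + p y"
    and p_scale: "\<And>c x. x \<in> V \<Longrightarrow> p (scale c x) \<le> norm c * p x"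
    and v: "v \<in> V" and d: "d > 0" "\<And>s. s \<in> S \<Longrightarrow> d \<le> p (v - s)"
  obtains g where "\<And>x y. x \<in> V \<Longrightarrow> y \<in> V \<Longrightarrow> g (x + y) = g x + g y"
    "\<And>c x. x \<in> V \<Longrightarrow> g (scale c x) = c * g x" "\<And>x. x \<in> V \<Longrightarrow> norm (g x) \<le> p x"
    "\<And>x. x \<in> S \<Longrightarrow> g x = 0" "g v \<noteq> 0"
proof -
  let ?\<Gamma> = "{(s + scale (of_real t) v, t * d) |s t. s \<in> S \<and> t \<ge> 0}"
  have cone: "convex_cone ?\<Gamma>"
    unfolding convex_cone_def
  proof (intro conjI allI impI)
    show "(0, 0) \<in> ?\<Gamma>"
      using subspace_0[OF S(1)] by (auto intro!: exI[of _ 0])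
    fix c g c' g' assume "(c, g) \<in> ?\<Gamma>" "(c', g') \<in> ?\<Gamma>"
    then obtain s t s' t' where "c = s + scale (of_real t) v" "g = t * d" "s \<in> S" "t \<ge> 0"
      "c' = s' + scale (of_real t') v" "g' = t' * d" "s' \<in> S" "t' \<ge> 0" by auto
    then show "(c + c', g + g') \<in> ?\<Gamma>"
      using subspace_add[OF S(1)]
      by (auto intro!: exI[of _ "s + s'"] exI[of _ "t + t'"] simp: algebra_simps scale_left_distrib)
  next
    fix u :: real and c g assume "u > 0" "(c, g) \<in> ?\<Gamma>"
    then obtain s t where "c = s + scale (of_real t) v" "g = t * d" "s \<in> S" "t \<ge> 0" by auto
    then show "(scale (of_real u) c, u * g) \<in> ?\<Gamma>"
      using subspace_scale[OF S(1)] \<open>u > 0\<close>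
      by (auto intro!: exI[of _ "scale (of_real u) s"] exI[of _ "u * t"] simp: scale_right_distrib)
  qed
  have p0: "p 0 = 0"
    using p_add[of 0 0] p_scale[of 0 0] subspace_0[OF V] by auto
  have nonneg: "0 \<le> p x" if x: "x \<in> V" for x
    using p_add[OF x subspace_neg[OF V x]] p_scale[OF x, of "- 1"] p0 by simp
  have le: "c \<in> V \<and> g \<le> p c" if cg: "(c, g) \<in> ?\<Gamma>" for c g
  proof -
    obtain s t where c: "c = s + scale (of_real t) v" "g = t * d" "s \<in> S" "t \<ge> 0"
      using cg by blast
    have cV: "c \<in> V" using c S(2) v V by (auto intro!: subspace_add subspace_scale)
    show ?thesis
    proof (cases "t = 0")
      case True
      then show ?thesis using cV nonneg c by simp
    next
      case False
      then have t: "t > 0" using c by simp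
      \<comment> \<open>Division by \<open>t\<close> turns \<open>s + t v\<close> into
        \<open>v\<close> minus an element of \<open>S\<close>, where \<open>p\<close> is at least
        \<open>d\<close>.\<close>
      have "d \<le> p (v - scale (of_real (- inverse t)) s)"
        using c by (intro d subspace_scale[OF S(1)])
      also have "v - scale (of_real (- inverse t)) s = scale (of_real (inverse t)) c"
        using t by (simp add: c scale_right_distrib flip: of_real_mult)
      also have "p \<dots> \<le> inverse t * p c" using p_scale[OF cV, of "of_real (inverse t)"] t by (simp add: norm_inverse)
      finally show ?thesis using cV t c by (simp add: field_simps)
    qed
  qed
  obtain g where g: "\<And>x y. x \<in> V \<Longrightarrow> y \<in> V \<Longrightarrow> g (x + y) = g x + g y"
    "\<And>c x. x \<in> V \<Longrightarrow> g (scale c x) = c * g x" "\<And>x. x \<in> V \<Longrightarrow> norm (g x) \<le> p x"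
    "\<And>c h. (c, h) \<in> ?\<Gamma> \<Longrightarrow> h \<le> inner (g c) 1"
    using hahn_banach_cone[OF V p_add p_scale cone le] by blast
  have "(v, d) \<in> ?\<Gamma>" using subspace_0[OF S(1)] by (auto intro!: exI[of _ 0] exI[of _ 1])
  from g(4)[OF this] d(1) have gv: "g v \<noteq> 0" by auto
  have ge: "0 \<le> inner (g s) 1" if "s \<in> S" for s
    using that by (intro g(4)) (intro CollectI exI[of _ s] exI[of _ "0::real"], simp)
  have "g s = 0" if s: "s \<in> S" for s
  proof (rule inner_mult_one_eqD)
    fix c
    have "0 \<le> inner (c * g s) 1" for c
      using ge[OF subspace_scale[OF S(1) s, of c]] g(2)[of s c] s S(2) by auto
    from this[of c] this[of "- c"] show "inner (c * g s) 1 = inner (c * 0) 1" by simp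
  qed
  then show thesis using that g(1-3) gv by blast
qed

end

section \<open>Duals and biduals of closed ideals\<close>

text \<open>Duals are subspaces of this space of all functions, and \<open>onorm\<close> is a
  seminorm only on them; hence the explicit subspace \<open>V\<close> in the Hahn-Banach
  statements.\<close>

interpretation fun_space: normed_scalar_space
  "\<lambda>(c::'k::{real_normed_field,euclidean_space}) (\<phi>::'v \<Rightarrow> 'k) x. c * \<phi> x"
  by unfold_locales (auto simp: fun_eq_iff algebra_simps)

text \<open>The bound makes the quotients in \<open>onorm\<close> bounded above, so that their
  supremum really dominates each of them.\<close>

lemma
  assumes "\<And>x. norm (f x) \<le> C * norm x"
  shows norm_le_onorm: "norm (f x) \<le> onorm f * norm x" and onorm_nonneg: "0 \<le> onorm f"
proof -
  have "norm (f y) / norm y \<le> \<bar>C\<bar>" for y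
    using assms[of y] by (cases "y = 0") (auto simp: divide_simps intro: order_trans mult_right_mono)
  then have "bdd_above (range (\<lambda>y. norm (f y) / norm y))"
    by (intro bdd_aboveI2) auto
  then have le: "norm (f y) / norm y \<le> onorm f" for y
    unfolding onorm_def by (rule cSUP_upper[OF UNIV_I])
  \<comment> \<open>The quotient at \<open>0\<close> equals \<open>0\<close>, since division by
    \<open>0\<close> gives \<open>0\<close>.\<close>
  show "0 \<le> onorm f" using le[of 0] by simp
  show "norm (f x) \<le> onorm f * norm x"
    using le[of x] assms[of 0] by (cases "x = 0") (auto simp: field_simps)
qed

section \<open>Functionals on a closed ideal and the module actions\<close>

locale banach_ideal = banach_algebra smul
  for smul :: "'k::{real_normed_field,euclidean_space} \<Rightarrow> 'a::{real_normed_algebra,banach} \<Rightarrow> 'a" +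
  fixes B :: "'a set"
  assumes closed_ideal: "closed_ideal smul B"

sublocale banach_algebra \<subseteq> normed_scalar_space smul
  by unfold_locales

text \<open>The algebra is an ideal of itself, so each fact about duals and biduals is available for
  both under the prefix \<open>whole\<close>.\<close>

sublocale banach_algebra \<subseteq> whole: banach_ideal smul UNIV
  by unfold_locales (simp add: closed_ideal_def subspace_UNIV)

context banach_ideal
begin

lemma ideal_subspace: "subspace B" and ideal_closed: "closed B"
  and ideal_left: "x \<in> B \<Longrightarrow> a * x \<in> B" and ideal_right: "x \<in> B \<Longrightarrow> x * a \<in> B"
  using closed_ideal by (auto simp: closed_ideal_def)

lemmas ideal_add = subspace_add[OF ideal_subspace]
  and ideal_scale = subspace_scale[OF ideal_subspace]

lemma dualI:
  assumes "\<And>x y. x \<in> B \<Longrightarrow> y \<in> B \<Longrightarrow> \<phi> (x + y) = \<phi> x + \<phi> y"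
    and "\<And>c x. x \<in> B \<Longrightarrow> \<phi> (smul c x) = c * \<phi> x"
    and "\<And>x. x \<in> B \<Longrightarrow> norm (\<phi> x) \<le> C * norm x"
    and "\<And>x. x \<notin> B \<Longrightarrow> \<phi> x = 0"
  shows "\<phi> \<in> dual smul B"
  using assms unfolding dual_def continuous_dual_def by blast

context
  fixes \<phi> assumes \<phi>: "\<phi> \<in> dual smul B"
begin

lemma dual_add: "x \<in> B \<Longrightarrow> y \<in> B \<Longrightarrow> \<phi> (x + y) = \<phi> x + \<phi> y"
  and dual_scale: "x \<in> B \<Longrightarrow> \<phi> (smul c x) = c * \<phi> x"
  and dual_outside: "x \<notin> B \<Longrightarrow> \<phi> x = 0"
  using \<phi> by (auto simp: dual_def continuous_dual_def)

lemma dual_le_onorm: "norm (\<phi> x) \<le> onorm \<phi> * norm x"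
  and onorm_dual_nonneg: "0 \<le> onorm \<phi>"
proof -
  obtain C where C: "\<And>x. x \<in> B \<Longrightarrow> norm (\<phi> x) \<le> C * norm x"
    using \<phi> unfolding dual_def continuous_dual_def by blast
  have "norm (\<phi> x) \<le> \<bar>C\<bar> * norm x" for x
  proof (cases "x \<in> B")
    case True
    have "C * norm x \<le> \<bar>C\<bar> * norm x" by (intro mult_right_mono) auto
    then show ?thesis using C[OF True] by simp
  qed (simp add: dual_outside)
  then show "norm (\<phi> x) \<le> onorm \<phi> * norm x" "0 \<le> onorm \<phi>"
    by (rule norm_le_onorm, rule onorm_nonneg)
qed

lemma dual_smult: "(\<lambda>x. c * \<phi> x) \<in> dual smul B"
  and onorm_dual_smult: "onorm (\<lambda>x. c * \<phi> x) \<le> norm c * onorm \<phi>"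
proof -
  have le: "norm (c * \<phi> x) \<le> (norm c * onorm \<phi>) * norm x" for x
    using dual_le_onorm[of x] by (simp add: norm_mult mult.assoc mult_left_mono)
  show "(\<lambda>x. c * \<phi> x) \<in> dual smul B" using le
    by (intro dualI[where C = "norm c * onorm \<phi>"]) (auto simp: dual_add dual_scale dual_outside distrib_left mult.left_commute)
  show "onorm (\<lambda>x. c * \<phi> x) \<le> norm c * onorm \<phi>"
    using le onorm_dual_nonneg by (intro onorm_bound) auto
qed

lemma dual_plus:
  assumes \<psi>: "\<psi> \<in> dual smul B"
  shows "(\<lambda>x. \<phi> x + \<psi> x) \<in> dual smul B"
proof (rule dualI)
  have \<psi>': "norm (\<psi> x) \<le> onorm \<psi> * norm x" for x
    using banach_ideal.dual_le_onorm[OF banach_ideal_axioms \<psi>] .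
  show "norm (\<phi> x + \<psi> x) \<le> (onorm \<phi> + onorm \<psi>) * norm x" for x
    using dual_le_onorm[of x] \<psi>'[of x] norm_triangle_ineq[of "\<phi> x" "\<psi> x"]
    by (simp add: distrib_right)
qed (use \<psi> in \<open>auto simp: dual_def continuous_dual_def dual_add dual_scale dual_outside algebra_simps\<close>)

lemma dual_ract_in_dual: "dual_ract B \<phi> a \<in> dual smul B"
  and onorm_dual_ract: "onorm (dual_ract B \<phi> a) \<le> onorm \<phi> * norm a"
proof -
  have le: "norm (dual_ract B \<phi> a x) \<le> (onorm \<phi> * norm a) * norm x" for x
  proof -
    have "norm (\<phi> (a * x)) \<le> onorm \<phi> * (norm a * norm x)"
      using dual_le_onorm[of "a * x"] norm_mult_ineq[of a x] onorm_dual_nonneg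
      by (meson mult_left_mono order_trans)
    then show ?thesis
      using onorm_dual_nonneg by (simp add: dual_ract_def zext_def mult.assoc)
  qed
  show "dual_ract B \<phi> a \<in> dual smul B"
  proof (rule dualI)
    show "norm (dual_ract B \<phi> a x) \<le> (onorm \<phi> * norm a) * norm x" for x by (rule le)
  qed (auto simp: dual_ract_def zext_def dual_add dual_scale ideal_left ideal_add ideal_scale distrib_left
      distrib_right smul_mult_left smul_mult_right)
  show "onorm (dual_ract B \<phi> a) \<le> onorm \<phi> * norm a"
    using le onorm_dual_nonneg by (intro onorm_bound) auto
qed

lemma dual_lact_in_dual: "dual_lact B a \<phi> \<in> dual smul B"
  and onorm_dual_lact: "onorm (dual_lact B a \<phi>) \<le> onorm \<phi> * norm a"
proof -
  have le: "norm (dual_lact B a \<phi> x) \<le> (onorm \<phi> * norm a) * norm x" for x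
  proof -
    have "norm (\<phi> (x * a)) \<le> onorm \<phi> * (norm a * norm x)"
      using dual_le_onorm[of "x * a"] norm_mult_ineq[of x a] onorm_dual_nonneg
      by (metis mult.commute mult_left_mono order_trans)
    then show ?thesis
      using onorm_dual_nonneg by (simp add: dual_lact_def zext_def mult.assoc)
  qed
  show "dual_lact B a \<phi> \<in> dual smul B"
  proof (rule dualI)
    show "norm (dual_lact B a \<phi> x) \<le> (onorm \<phi> * norm a) * norm x" for x by (rule le)
  qed (auto simp: dual_lact_def zext_def dual_add dual_scale ideal_right ideal_add ideal_scale distrib_left
      distrib_right smul_mult_left smul_mult_right)
  show "onorm (dual_lact B a \<phi>) \<le> onorm \<phi> * norm a"
    using le onorm_dual_nonneg by (intro onorm_bound) auto
qed

lemma dual_ract_add: "a \<in> B \<Longrightarrow> b \<in> B \<Longrightarrow> dual_ract B \<phi> (a + b) = (\<lambda>x. dual_ract B \<phi> a x + dual_ract B \<phi> b x)"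
  and dual_ract_smul: "a \<in> B \<Longrightarrow> dual_ract B \<phi> (smul c a) = (\<lambda>x. c * dual_ract B \<phi> a x)"
  by (auto simp: dual_ract_def zext_def fun_eq_iff distrib_right dual_add dual_scale ideal_left
      ideal_right smul_mult_left)

lemma dual_lact_add: "dual_lact B (a + b) \<phi> = (\<lambda>x. dual_lact B a \<phi> x + dual_lact B b \<phi> x)"
  and dual_lact_smul: "dual_lact B (smul c a) \<phi> = (\<lambda>x. c * dual_lact B a \<phi> x)"
  by (auto simp: dual_lact_def zext_def fun_eq_iff distrib_left dual_add dual_scale ideal_left
      ideal_right smul_mult_right)

end

lemma zero_in_dual: "(\<lambda>x. 0) \<in> dual smul B"
  by (rule dualI[where C = 0]) auto

lemma onorm_dual_plus:
  assumes "\<phi> \<in> dual smul B" "\<psi> \<in> dual smul B"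
  shows "onorm (\<lambda>x. \<phi> x + \<psi> x) \<le> onorm \<phi> + onorm \<psi>"
proof (rule onorm_bound)
  show "norm (\<phi> x + \<psi> x) \<le> (onorm \<phi> + onorm \<psi>) * norm x" for x
    using dual_le_onorm[OF assms(1), of x] dual_le_onorm[OF assms(2), of x]
      norm_triangle_ineq[of "\<phi> x" "\<psi> x"]
    by (simp add: distrib_right)
qed (use assms in \<open>auto simp: onorm_dual_nonneg\<close>)

lemma dual_minus:
  assumes "\<phi> \<in> dual smul B" "\<psi> \<in> dual smul B"
  shows "(\<lambda>x. \<phi> x - \<psi> x) \<in> dual smul B"
  using dual_plus[OF assms(1) dual_smult[OF assms(2), of "- 1"]] by simp

lemma dual_subspace: "fun_space.subspace (dual smul B)"
  unfolding fun_space.subspace_def plus_fun_def zero_fun_def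
  using dual_plus dual_smult zero_in_dual by blast

lemma bidualI:
  assumes "\<And>\<phi> \<psi>. \<phi> \<in> dual smul B \<Longrightarrow> \<psi> \<in> dual smul B \<Longrightarrow> m (\<lambda>x. \<phi> x + \<psi> x) = m \<phi> + m \<psi>"
    and "\<And>c \<phi>. \<phi> \<in> dual smul B \<Longrightarrow> m (\<lambda>x. c * \<phi> x) = c * m \<phi>"
    and "\<And>\<phi>. \<phi> \<in> dual smul B \<Longrightarrow> norm (m \<phi>) \<le> C * onorm \<phi>"
    and "\<And>\<phi>. \<phi> \<notin> dual smul B \<Longrightarrow> m \<phi> = 0"
  shows "m \<in> bidual smul B"
  using assms unfolding bidual_def continuous_dual_def by blast

lemma zero_in_bidual: "(\<lambda>\<phi>. 0) \<in> bidual smul B"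
  by (rule bidualI[where C = 0]) auto

context
  fixes m assumes m: "m \<in> bidual smul B"
begin

lemma bidual_add:
    "\<phi> \<in> dual smul B \<Longrightarrow> \<psi> \<in> dual smul B \<Longrightarrow> m (\<lambda>x. \<phi> x + \<psi> x) = m \<phi> + m \<psi>"
  and bidual_smult: "\<phi> \<in> dual smul B \<Longrightarrow> m (\<lambda>x. c * \<phi> x) = c * m \<phi>"
  and bidual_outside: "\<phi> \<notin> dual smul B \<Longrightarrow> m \<phi> = 0"
  using m by (auto simp: bidual_def continuous_dual_def)

lemma bidual_zero: "m (\<lambda>x. 0) = 0"
  using bidual_smult[OF zero_in_dual, of 0] by simp

lemma bidual_diff:
  assumes "\<phi> \<in> dual smul B" "\<psi> \<in> dual smul B"
  shows "m (\<lambda>x. \<phi> x - \<psi> x) = m \<phi> - m \<psi>"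
  using bidual_add[OF assms(1) dual_smult[OF assms(2), of "- 1"]] bidual_smult[OF assms(2), of "- 1"]
  by simp

lemma bidual_bounded:
  obtains C where "C \<ge> 0" "\<And>\<phi>. \<phi> \<in> dual smul B \<Longrightarrow> norm (m \<phi>) \<le> C * onorm \<phi>"
proof -
  obtain C where C: "\<And>\<phi>. \<phi> \<in> dual smul B \<Longrightarrow> norm (m \<phi>) \<le> C * onorm \<phi>"
    using m unfolding bidual_def continuous_dual_def by blast
  have "norm (m \<phi>) \<le> \<bar>C\<bar> * onorm \<phi>" if "\<phi> \<in> dual smul B" for \<phi>
    using C[OF that] mult_right_mono[OF abs_ge_self onorm_dual_nonneg[OF that], of C]
    by (rule order_trans)
  then show thesis using that[of "\<bar>C\<bar>"] by simp
qed

context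
  fixes \<phi> assumes \<phi>: "\<phi> \<in> dual smul B"
begin

lemma bidual_lact_in_dual: "bidual_lact B m \<phi> \<in> dual smul B"
proof -
  obtain C where C: "C \<ge> 0" "\<And>\<phi>. \<phi> \<in> dual smul B \<Longrightarrow> norm (m \<phi>) \<le> C * onorm \<phi>"
    using bidual_bounded by blast
  have "norm (m (dual_ract B \<phi> a)) \<le> (C * onorm \<phi>) * norm a" for a
    using C(2)[OF dual_ract_in_dual[OF \<phi>]] mult_left_mono[OF onorm_dual_ract[OF \<phi>] C(1)]
    by (metis mult.assoc order_trans)
  then show ?thesis
    by (intro dualI)
      (auto simp: bidual_lact_def zext_def ideal_add ideal_scale dual_ract_add[OF \<phi>]
        dual_ract_smul[OF \<phi>] bidual_add bidual_smult dual_ract_in_dual[OF \<phi>])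
qed

lemma bidual_ract_in_dual: "bidual_ract B \<phi> m \<in> dual smul B"
proof -
  obtain C where C: "C \<ge> 0" "\<And>\<phi>. \<phi> \<in> dual smul B \<Longrightarrow> norm (m \<phi>) \<le> C * onorm \<phi>"
    using bidual_bounded by blast
  have "norm (m (dual_lact B a \<phi>)) \<le> (C * onorm \<phi>) * norm a" for a
    using C(2)[OF dual_lact_in_dual[OF \<phi>]] mult_left_mono[OF onorm_dual_lact[OF \<phi>] C(1)]
    by (metis mult.assoc order_trans)
  then show ?thesis
    by (intro dualI)
      (auto simp: bidual_ract_def zext_def ideal_add ideal_scale dual_lact_add[OF \<phi>]
        dual_lact_smul[OF \<phi>] bidual_add bidual_smult dual_lact_in_dual[OF \<phi>])
qed

lemma bidual_lact_smult: "bidual_lact B m (\<lambda>x. c * \<phi> x) = (\<lambda>x. c * bidual_lact B m \<phi> x)"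
proof -
  have "dual_ract B (\<lambda>x. c * \<phi> x) a = (\<lambda>x. c * dual_ract B \<phi> a x)" for a
    by (auto simp: dual_ract_def zext_def)
  then show ?thesis
    by (auto simp: bidual_lact_def zext_def bidual_smult dual_ract_in_dual[OF \<phi>])
qed

lemma bidual_ract_smult: "bidual_ract B (\<lambda>x. c * \<phi> x) m = (\<lambda>x. c * bidual_ract B \<phi> m x)"
proof -
  have "dual_lact B a (\<lambda>x. c * \<phi> x) = (\<lambda>x. c * dual_lact B a \<phi> x)" for a
    by (auto simp: dual_lact_def zext_def)
  then show ?thesis
    by (auto simp: bidual_ract_def zext_def bidual_smult dual_lact_in_dual[OF \<phi>])
qed

lemma bidual_lact_plus:
  assumes \<psi>: "\<psi> \<in> dual smul B"
  shows "bidual_lact B m (\<lambda>x. \<phi> x + \<psi> x) = (\<lambda>x. bidual_lact B m \<phi> x + bidual_lact B m \<psi> x)"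
proof -
  have "dual_ract B (\<lambda>x. \<phi> x + \<psi> x) a = (\<lambda>x. dual_ract B \<phi> a x + dual_ract B \<psi> a x)" for a
    by (auto simp: dual_ract_def zext_def)
  then show ?thesis
    by (auto simp: bidual_lact_def zext_def bidual_add dual_ract_in_dual[OF \<phi>] dual_ract_in_dual[OF \<psi>])
qed

lemma bidual_ract_plus:
  assumes \<psi>: "\<psi> \<in> dual smul B"
  shows "bidual_ract B (\<lambda>x. \<phi> x + \<psi> x) m = (\<lambda>x. bidual_ract B \<phi> m x + bidual_ract B \<psi> m x)"
proof -
  have "dual_lact B a (\<lambda>x. \<phi> x + \<psi> x) = (\<lambda>x. dual_lact B a \<phi> x + dual_lact B a \<psi> x)" for a
    by (auto simp: dual_lact_def zext_def)
  then show ?thesis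
    by (auto simp: bidual_ract_def zext_def bidual_add dual_lact_in_dual[OF \<phi>] dual_lact_in_dual[OF \<psi>])
qed

end

end

lemma canonical_in_bidual: "canonical smul B a \<in> bidual smul B"
proof (rule bidualI[where C = "norm a"])
  show "norm (canonical smul B a \<phi>) \<le> norm a * onorm \<phi>" if "\<phi> \<in> dual smul B" for \<phi>
    using dual_le_onorm[OF that, of a] that by (simp add: canonical_def zext_def mult.commute)
qed (auto simp: canonical_def zext_def dual_plus dual_smult)

end

section \<open>Restriction, extension and separation of functionals\<close>

context banach_ideal
begin

lemma
  assumes \<phi>: "\<phi> \<in> dual smul UNIV"
  shows restrict_in_dual: "zext B \<phi> \<in> dual smul B" and onorm_restrict: "onorm (zext B \<phi>) \<le> onorm \<phi>"
proof -
  have le: "norm (zext B \<phi> x) \<le> onorm \<phi> * norm x" for x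
    using whole.dual_le_onorm[OF \<phi>, of x] whole.onorm_dual_nonneg[OF \<phi>] by (simp add: zext_def)
  show "zext B \<phi> \<in> dual smul B"
  proof (rule dualI)
    show "norm (zext B \<phi> x) \<le> onorm \<phi> * norm x" for x by (rule le)
  qed (auto simp: zext_def whole.dual_add[OF \<phi>] whole.dual_scale[OF \<phi>] ideal_add ideal_scale)
  show "onorm (zext B \<phi>) \<le> onorm \<phi>"
    using le whole.onorm_dual_nonneg[OF \<phi>] by (intro onorm_bound) auto
qed

text \<open>This is the second adjoint of the inclusion, embedding the bidual of the ideal into that
  of the algebra.\<close>

definition lift where
  "lift m = zext (dual smul UNIV) (\<lambda>\<phi>. m (zext B \<phi>))"

lemma lift_in_bidual:
  assumes m: "m \<in> bidual smul B"
  shows "lift m \<in> bidual smul UNIV"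
proof -
  obtain C where C: "C \<ge> 0" "\<And>\<phi>. \<phi> \<in> dual smul B \<Longrightarrow> norm (m \<phi>) \<le> C * onorm \<phi>"
    using bidual_bounded[OF m] by blast
  have "zext B (\<lambda>x. \<phi> x + \<psi> x) = (\<lambda>x. zext B \<phi> x + zext B \<psi> x)"
    "zext B (\<lambda>x. c * \<phi> x) = (\<lambda>x. c * zext B \<phi> x)" for \<phi> \<psi> :: "'a \<Rightarrow> 'k" and c
    by (auto simp: zext_def)
  then show ?thesis
  proof (intro whole.bidualI)
    show "norm (lift m \<phi>) \<le> C * onorm \<phi>" if "\<phi> \<in> dual smul UNIV" for \<phi>
      using C(2)[OF restrict_in_dual[OF that]] mult_left_mono[OF onorm_restrict[OF that] C(1)] that
      by (simp add: lift_def zext_def)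
  qed (auto simp: lift_def zext_def[of "dual smul UNIV"] restrict_in_dual whole.dual_plus whole.dual_smult
      bidual_add[OF m] bidual_smult[OF m])
qed

text \<open>Hahn-Banach with dominating seminorm \<open>onorm \<phi> * norm x\<close>. It transfers
  computations with functionals on the algebra to functionals on the ideal.\<close>

lemma dual_extend:
  assumes \<phi>: "\<phi> \<in> dual smul B"
  obtains \<phi>' where "\<phi>' \<in> dual smul UNIV" "zext B \<phi>' = \<phi>"
proof -
  obtain g where g: "\<And>x y. g (x + y) = g x + g y" "\<And>c x. g (smul c x) = c * g x"
    "\<And>x. norm (g x) \<le> onorm \<phi> * norm x" "\<And>x. x \<in> B \<Longrightarrow> g x = \<phi> x"
  proof (rule hahn_banach_extension[OF subspace_UNIV ideal_subspace, of "\<lambda>x. onorm \<phi> * norm x" \<phi>])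
    show "onorm \<phi> * norm (x + y) \<le> onorm \<phi> * norm x + onorm \<phi> * norm y" for x y
      using mult_left_mono[OF norm_triangle_ineq onorm_dual_nonneg[OF \<phi>]] by (simp add: distrib_left)
  qed (auto simp: dual_add[OF \<phi>] dual_scale[OF \<phi>] norm_smul dual_le_onorm[OF \<phi>])
  show thesis
  proof (rule that)
    show "g \<in> dual smul UNIV" using g by (intro whole.dualI) auto
    show "zext B g = \<phi>" using g(4) dual_outside[OF \<phi>] by (auto simp: zext_def)
  qed
qed

text \<open>As the ideal is closed, a ball around \<open>y\<close> misses it, and its radius bounds
  the distance in the separation theorem from below.\<close>

lemma separate_point:
  assumes "y \<notin> B"
  obtains \<psi> where "\<psi> \<in> dual smul UNIV" "zext B \<psi> = (\<lambda>x. 0)" "\<psi> y \<noteq> 0"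
proof -
  have "open (- B)" using ideal_closed by (rule open_Compl)
  then obtain d where d: "d > 0" "ball y d \<subseteq> - B"
    using assms open_contains_ball by (metis ComplI)
  obtain g where g: "\<And>x y. g (x + y) = g x + g y" "\<And>c x. g (smul c x) = c * g x"
    "\<And>x. norm (g x) \<le> norm x" "\<And>x. x \<in> B \<Longrightarrow> g x = 0" "g y \<noteq> 0"
  proof (rule hahn_banach_separation[OF subspace_UNIV ideal_subspace, of norm y d])
    show "d \<le> norm (y - s)" if "s \<in> B" for s
      using d(2) that by (auto simp: subset_iff dist_norm not_less dest: spec[of _ s])
  qed (auto simp: norm_triangle_ineq norm_smul d)
  show thesis
  proof (rule that)
    show "g \<in> dual smul UNIV" using g by (intro whole.dualI[where C = 1]) auto
    show "zext B g = (\<lambda>x. 0)" using g(4) by (auto simp: zext_def)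
  qed (rule g(5))
qed

text \<open>Separation is applied inside the dual with seminorm \<open>onorm\<close>. Not lying in
  the norm closure supplies the positive distance, and \<open>zext\<close> makes the result vanish
  off the dual.\<close>

lemma separate_dual:
  assumes S: "fun_space.subspace S" "S \<subseteq> dual smul B"
    and \<phi>: "\<phi> \<in> dual smul B" "\<phi> \<notin> dual_closure smul B S"
  obtains r where "r \<in> bidual smul B" "\<And>\<psi>. \<psi> \<in> S \<Longrightarrow> r \<psi> = 0" "r \<phi> \<noteq> 0"
proof -
  obtain d where d: "d > 0" "\<And>\<psi>. \<psi> \<in> S \<Longrightarrow> d \<le> onorm (\<lambda>x. \<phi> x - \<psi> x)"
    using \<phi> by (auto simp: dual_closure_def not_less)
  obtain g where g: "\<And>\<phi> \<psi>. \<phi> \<in> dual smul B \<Longrightarrow> \<psi> \<in> dual smul B \<Longrightarrow> g (\<phi> + \<psi>) = g \<phi> + g \<psi>"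
    "\<And>c \<phi>. \<phi> \<in> dual smul B \<Longrightarrow> g (\<lambda>x. c * \<phi> x) = c * g \<phi>"
    "\<And>\<phi>. \<phi> \<in> dual smul B \<Longrightarrow> norm (g \<phi>) \<le> onorm \<phi>"
    "\<And>\<psi>. \<psi> \<in> S \<Longrightarrow> g \<psi> = 0" "g \<phi> \<noteq> 0"
    by (rule fun_space.hahn_banach_separation[OF dual_subspace S, of onorm \<phi> d])
      (use d \<phi>(1) in \<open>auto simp: plus_fun_def fun_diff_def onorm_dual_plus onorm_dual_smult\<close>)
  show thesis
  proof (rule that)
    show "zext (dual smul B) g \<in> bidual smul B"
      using g by (intro bidualI[where C = 1]) (auto simp: zext_def dual_plus dual_smult plus_fun_def)
    show "zext (dual smul B) g \<psi> = 0" if "\<psi> \<in> S" for \<psi>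
      using g(4)[OF that] by (simp add: zext_def)
    show "zext (dual smul B) g \<phi> \<noteq> 0" using g(5) \<phi>(1) by (simp add: zext_def)
  qed
qed

end

section \<open>Weak compactness and weakly almost periodic functionals\<close>

lemma setcompr_eq_singleton_iff:
  assumes "\<exists>x y. P x y"
  shows "{f x y |x y. P x y} = {c} \<longleftrightarrow> (\<forall>x y. P x y \<longrightarrow> f x y = c)"
  using assms by (auto simp: set_eq_iff)

lemma openin_weak_topology: "f \<in> F \<Longrightarrow> open U \<Longrightarrow> openin (weak_topology V F) {x \<in> V. f x \<in> U}"
  unfolding weak_topology_def by (rule topology_generated_by_Basis) blast

lemma topspace_weak_topology:
  assumes "F \<noteq> {}"
  shows "topspace (weak_topology V F) = V"
  using assms unfolding weak_topology_def topology_generated_by_topspace by (auto intro: open_UNIV)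

lemma closedin_weak_topology:
  fixes f :: "'v \<Rightarrow> 'k::t1_space"
  assumes "f \<in> F"
  shows "closedin (weak_topology V F) {x \<in> V. f x = c}"
proof -
  have "openin (weak_topology V F) {x \<in> V. f x \<in> - {c}}"
    by (rule openin_weak_topology[OF assms]) (rule open_Compl, simp)
  moreover have "V - {x \<in> V. f x = c} = {x \<in> V. f x \<in> - {c}}" by auto
  moreover have "topspace (weak_topology V F) = V" using assms by (intro topspace_weak_topology) auto
  ultimately show ?thesis by (auto simp: closedin_def)
qed

lemma Hausdorff_weak_topology:
  fixes F :: "('v \<Rightarrow> 'k::t2_space) set"
  assumes "F \<noteq> {}" and "\<And>x y. x \<in> V \<Longrightarrow> y \<in> V \<Longrightarrow> x \<noteq> y \<Longrightarrow> \<exists>f\<in>F. f x \<noteq> f y"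
  shows "Hausdorff_space (weak_topology V F)"
  unfolding Hausdorff_space_def topspace_weak_topology[OF assms(1)]
proof (intro allI impI)
  fix x y assume xy: "x \<in> V \<and> y \<in> V \<and> x \<noteq> y"
  then obtain f where f: "f \<in> F" "f x \<noteq> f y" using assms(2) by blast
  then obtain U W where UW: "open U" "open W" "f x \<in> U" "f y \<in> W" "U \<inter> W = {}"
    using hausdorff by metis
  show "\<exists>U W. openin (weak_topology V F) U \<and> openin (weak_topology V F) W \<and> x \<in> U \<and> y \<in> W \<and> disjnt U W"
    by (rule exI[of _ "{x \<in> V. f x \<in> U}"], rule exI[of _ "{x \<in> V. f x \<in> W}"])
      (use xy UW f in \<open>auto simp: disjnt_def openin_weak_topology\<close>)
qed

section \<open>Functionals at which the two Arens products agree\<close>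

context banach_algebra
begin

lemma tendsto_dual:
  assumes \<phi>: "\<phi> \<in> dual smul UNIV" and x: "(x \<longlongrightarrow> y) F"
  shows "((\<lambda>i. \<phi> (x i)) \<longlongrightarrow> \<phi> y) F"
proof -
  have "((\<lambda>i. \<phi> (x i - y)) \<longlongrightarrow> 0) F"
  proof (rule Lim_null_comparison)
    show "eventually (\<lambda>i. norm (\<phi> (x i - y)) \<le> onorm \<phi> * norm (x i - y)) F"
      using whole.dual_le_onorm[OF \<phi>] by simp
    show "((\<lambda>i. onorm \<phi> * norm (x i - y)) \<longlongrightarrow> 0) F"
      using LIM_zero[OF x] by (intro tendsto_mult_right_zero tendsto_norm_zero)
  qed
  moreover have "\<phi> (x i - y) = \<phi> (x i) - \<phi> y" for i
    using whole.dual_add[OF \<phi>, of "x i - y" y] by simp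
  ultimately show ?thesis by (simp add: LIM_zero_iff)
qed

text \<open>The condition equates the two Arens products of \<open>n\<close> and \<open>m\<close> at
  \<phi>. It is visibly linear in \<phi>, so this set can serve in place of \<open>WAP\<close> where
  separation requires a subspace.\<close>

definition arens_commuting :: "('a \<Rightarrow> 'k) set" where
  "arens_commuting = {\<phi> \<in> dual smul UNIV. \<forall>m\<in>bidual smul UNIV. \<forall>n\<in>bidual smul UNIV.
     n (bidual_lact UNIV m \<phi>) = m (bidual_ract UNIV \<phi> n)}"

lemma subspace_arens_commuting: "fun_space.subspace arens_commuting"
  unfolding fun_space.subspace_def plus_fun_def zero_fun_def
proof (intro conjI ballI allI)
  have zero: "dual_ract UNIV (\<lambda>x. 0) a = (\<lambda>x. 0 :: 'k)" "dual_lact UNIV a (\<lambda>x. 0) = (\<lambda>x. 0 :: 'k)" for a :: 'a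
    by (auto simp: dual_ract_def dual_lact_def zext_def)
  then show "(\<lambda>x. 0) \<in> arens_commuting"
    by (auto simp: arens_commuting_def whole.zero_in_dual bidual_lact_def bidual_ract_def zext_def
        whole.bidual_zero)
qed (auto simp: arens_commuting_def whole.dual_plus whole.dual_smult whole.bidual_lact_plus
    whole.bidual_ract_plus whole.bidual_add whole.bidual_lact_in_dual whole.bidual_ract_in_dual
    whole.bidual_lact_smult whole.bidual_ract_smult whole.bidual_smult)

text \<open>The Banach-Alaoglu theorem. The topology of the function type is pointwise convergence,
  so the ball is a closed subset of a product of compact balls, with radius \<open>0\<close> at
  arguments outside the dual.\<close>

lemma compact_bidual_ball:
  "compact {m \<in> bidual smul UNIV. \<forall>\<phi>\<in>dual smul UNIV. norm (m \<phi>) \<le> onorm \<phi>}"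
    (is "compact ?K")
proof -
  let ?D = "dual smul UNIV"
  let ?P = "PiE UNIV (\<lambda>\<phi>. cball (0::'k) (if \<phi> \<in> ?D then onorm \<phi> else 0))"
  have "compactin (product_topology (\<lambda>_. euclidean) UNIV) ?P"
    by (subst compactin_PiE) (simp add: compactin_euclidean_iff)
  then have P: "compact ?P" by (simp add: euclidean_product_topology compactin_euclidean_iff)
  have "closed ((\<Inter>\<phi>\<in>?D. \<Inter>\<psi>\<in>?D. {m :: ('a \<Rightarrow> 'k) \<Rightarrow> 'k. m (\<lambda>x. \<phi> x + \<psi> x) = m \<phi> + m \<psi>}) \<inter>
      (\<Inter>c. \<Inter>\<phi>\<in>?D. {m. m (\<lambda>x. c * \<phi> x) = c * m \<phi>}))" (is "closed ?L")
    by (intro closed_Int closed_INT ballI closed_Collect_eq continuous_on_add continuous_on_mult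
        continuous_on_const continuous_on_product_coordinates)
  moreover have "?K = ?P \<inter> ?L"
  proof (intro equalityI subsetI)
    fix m assume m: "m \<in> ?K"
    then show "m \<in> ?P \<inter> ?L"
      by (auto simp: whole.bidual_add whole.bidual_smult whole.bidual_outside)
  next
    fix m assume "m \<in> ?P \<inter> ?L"
    then have le: "norm (m \<phi>) \<le> (if \<phi> \<in> ?D then onorm \<phi> else 0)"
      and lin: "\<phi> \<in> ?D \<Longrightarrow> \<psi> \<in> ?D \<Longrightarrow> m (\<lambda>x. \<phi> x + \<psi> x) = m \<phi> + m \<psi>"
        "\<phi> \<in> ?D \<Longrightarrow> m (\<lambda>x. c * \<phi> x) = c * m \<phi>" for c \<phi> \<psi>
      by (auto simp: PiE_iff dist_norm)
    have "m \<in> bidual smul UNIV"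
    proof (rule whole.bidualI)
      show "norm (m \<phi>) \<le> 1 * onorm \<phi>" if "\<phi> \<in> ?D" for \<phi> using le[of \<phi>] that by simp
      show "m \<phi> = 0" if "\<phi> \<notin> ?D" for \<phi> using le[of \<phi>] that by simp
    qed (use lin in auto)
    then show "m \<in> ?K" using le by (auto split: if_splits) (metis (full_types))
  qed
  ultimately show ?thesis using compact_Int_closed[OF P] by simp
qed

text \<open>
  The unit ball of the bidual is weak-star compact and contains the unit ball of the algebra, and
  commutation makes \<open>m \<mapsto> m \<cdot> \<phi>\<close> continuous from the weak-star to the weak topology.
\<close>

lemma arens_commuting_subset_WAP: "arens_commuting \<subseteq> WAP smul UNIV"
proof
  fix \<phi> assume "\<phi> \<in> arens_commuting"
  then have \<phi>: "\<phi> \<in> dual smul UNIV"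
    and comm: "\<And>m n. m \<in> bidual smul UNIV \<Longrightarrow> n \<in> bidual smul UNIV \<Longrightarrow>
      n (bidual_lact UNIV m \<phi>) = m (bidual_ract UNIV \<phi> n)"
    by (auto simp: arens_commuting_def)
  let ?D = "dual smul UNIV" and ?M = "bidual smul UNIV"
  define \<sigma> where "\<sigma> = weak_topology ?D ?M"
  define K where "K = {m \<in> ?M. \<forall>\<phi>\<in>?D. norm (m \<phi>) \<le> onorm \<phi>}"
  have KM: "K \<subseteq> ?M" by (auto simp: K_def)
  have ne: "?M \<noteq> {}" using whole.zero_in_bidual by blast
  have "continuous_map (top_of_set K) \<sigma> (\<lambda>m. bidual_lact UNIV m \<phi>)"
    unfolding \<sigma>_def weak_topology_def
  proof (rule continuous_on_generated_topo)
    fix U assume "U \<in> {{x \<in> ?D. f x \<in> U} |f U. f \<in> ?M \<and> open U}"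
    then obtain n W where U: "U = {x \<in> ?D. n x \<in> W}" "n \<in> ?M" "open W" by blast
    have "(\<lambda>m. bidual_lact UNIV m \<phi>) -` U \<inter> K = K \<inter> {m. m (bidual_ract UNIV \<phi> n) \<in> W}"
      using KM whole.bidual_lact_in_dual[OF _ \<phi>] comm[OF _ U(2)] by (auto simp: U(1) subset_iff)
    moreover have "open {m. m (bidual_ract UNIV \<phi> n) \<in> W}"
      using open_vimage[OF U(3) continuous_on_product_coordinates[of "bidual_ract UNIV \<phi> n"]]
      by (simp add: vimage_def)
    ultimately show "openin (top_of_set K) ((\<lambda>m. bidual_lact UNIV m \<phi>) -` U \<inter> topspace (top_of_set K))"
      by (simp add: openin_open_Int)
  next
    \<comment> \<open>Continuity into a generated topology also requires the image to be covered by
      generators. The zero functional with \<open>UNIV\<close> gives the whole dual as a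
      generator.\<close>
    have "bidual_lact UNIV m \<phi> \<in> {x \<in> ?D. (\<lambda>_. 0) x \<in> (UNIV :: 'k set)}" if "m \<in> K" for m
      using that KM whole.bidual_lact_in_dual[OF _ \<phi>] by auto
    then show "(\<lambda>m. bidual_lact UNIV m \<phi>) ` topspace (top_of_set K) \<subseteq> \<Union> {{x \<in> ?D. f x \<in> U} |f U. f \<in> ?M \<and> open U}"
      using whole.zero_in_bidual open_UNIV by (auto; blast)
  qed
  moreover have "compactin (top_of_set K) K"
    using compact_bidual_ball by (simp add: compactin_subtopology K_def)
  ultimately have cpt: "compactin \<sigma> ((\<lambda>m. bidual_lact UNIV m \<phi>) ` K)"
    by (rule image_compactin[rotated])
  \<comment> \<open>In a Hausdorff space the compact image is closed, so it contains the closure of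
    the orbit of the unit ball.\<close>
  have "Hausdorff_space \<sigma>"
    unfolding \<sigma>_def
  proof (rule Hausdorff_weak_topology[OF ne])
    fix x y :: "'a \<Rightarrow> 'k" assume xy: "x \<in> ?D" "y \<in> ?D" "x \<noteq> y"
    then obtain a where "x a \<noteq> y a" by blast
    then have "canonical smul UNIV a x \<noteq> canonical smul UNIV a y" using xy by (simp add: canonical_def zext_def)
    then show "\<exists>f\<in>?M. f x \<noteq> f y" using whole.canonical_in_bidual by blast
  qed
  then have cl: "closedin \<sigma> ((\<lambda>m. bidual_lact UNIV m \<phi>) ` K)" using cpt by (rule compactin_imp_closedin)
  have "dual_lact UNIV a \<phi> \<in> (\<lambda>m. bidual_lact UNIV m \<phi>) ` K" if a: "norm a \<le> 1" for a
  proof (rule image_eqI)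
    show "dual_lact UNIV a \<phi> = bidual_lact UNIV (canonical smul UNIV a) \<phi>"
      using whole.dual_ract_in_dual[OF \<phi>]
      by (auto simp: bidual_lact_def canonical_def zext_def dual_lact_def dual_ract_def)
    have "norm (\<psi> a) \<le> onorm \<psi>" if "\<psi> \<in> ?D" for \<psi>
      using whole.dual_le_onorm[OF that, of a] mult_left_mono[OF a whole.onorm_dual_nonneg[OF that]] by simp
    then show "canonical smul UNIV a \<in> K"
      using whole.canonical_in_bidual by (auto simp: K_def canonical_def zext_def)
  qed
  then have "\<sigma> closure_of ((\<lambda>a. dual_lact UNIV a \<phi>) ` {a \<in> UNIV. norm a \<le> 1}) \<subseteq> (\<lambda>m. bidual_lact UNIV m \<phi>) ` K"
    by (intro closure_of_minimal[OF _ cl]) auto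
  then show "\<phi> \<in> WAP smul UNIV"
    using \<phi> closed_compactin[OF cpt]
    by (auto simp: WAP_def weakly_compact_into_dual_def Let_def simp flip: \<sigma>_def)
qed

end

section \<open>Ideals in an algebra that is an ideal in its bidual\<close>

locale ideal_in_bidual_setting = banach_ideal smul B
  for smul :: "'k::{real_normed_field,euclidean_space} \<Rightarrow> 'a::{real_normed_algebra,banach} \<Rightarrow> 'a"
    and B :: "'a set" +
  fixes F :: "'i filter" and e :: "'i \<Rightarrow> 'a"
  assumes ideal_in_bidual: "ideal_in_bidual smul UNIV"
    and approximate_identity: "bounded_approximate_identity F e"
begin

lemma tendsto_right_unit: "((\<lambda>i. a * e i) \<longlongrightarrow> a) F"
  and tendsto_left_unit: "((\<lambda>i. e i * a) \<longlongrightarrow> a) F"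
  and filter_nontrivial: "F \<noteq> bot"
  using approximate_identity by (auto simp: bounded_approximate_identity_def)

lemma eventually_bounded:
  obtains K where "K > 0" "eventually (\<lambda>i. norm (e i) \<le> K) F"
  using approximate_identity by (auto simp: bounded_approximate_identity_def Bfun_def)

text \<open>The left side is the product \<open>a m\<close> evaluated at \<psi>, and this product is
  the canonical image of some \<open>y\<close>.\<close>

lemma dual_ract_represented:
  assumes m: "m \<in> bidual smul UNIV"
  obtains y where "\<And>\<psi>. \<psi> \<in> dual smul UNIV \<Longrightarrow> m (dual_ract UNIV \<psi> a) = \<psi> y"
proof -
  obtain y where y: "arens1 smul UNIV (canonical smul UNIV a) m = canonical smul UNIV y"
    using ideal_in_bidual m by (auto simp: ideal_in_bidual_def)
  have "m (dual_ract UNIV \<psi> a) = \<psi> y" if \<psi>: "\<psi> \<in> dual smul UNIV" for \<psi>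
    using fun_cong[OF y, of \<psi>] \<psi> whole.bidual_lact_in_dual[OF m \<psi>]
    by (simp add: arens1_def canonical_def zext_def bidual_lact_def)
  then show thesis using that by blast
qed

text \<open>The mirror image, with the product \<open>m a\<close>: the canonical image of
  \<open>a\<close> acts on \<psi> as \<open>a\<close> does.\<close>

lemma dual_lact_represented:
  assumes m: "m \<in> bidual smul UNIV"
  obtains z where "\<And>\<psi>. \<psi> \<in> dual smul UNIV \<Longrightarrow> m (dual_lact UNIV a \<psi>) = \<psi> z"
proof -
  obtain z where z: "arens1 smul UNIV m (canonical smul UNIV a) = canonical smul UNIV z"
    using ideal_in_bidual m by (auto simp: ideal_in_bidual_def)
  have "m (dual_lact UNIV a \<psi>) = \<psi> z" if \<psi>: "\<psi> \<in> dual smul UNIV" for \<psi>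
  proof -
    have "bidual_lact UNIV (canonical smul UNIV a) \<psi> = dual_lact UNIV a \<psi>"
      using whole.dual_ract_in_dual[OF \<psi>]
      by (auto simp: bidual_lact_def canonical_def zext_def dual_lact_def dual_ract_def)
    then show ?thesis
      using fun_cong[OF z, of \<psi>] \<psi> by (simp add: arens1_def canonical_def zext_def)
  qed
  then show thesis using that by blast
qed

lemma restrict_dual_ract: "zext B (dual_ract UNIV \<psi> a) = dual_ract B (zext B \<psi>) a"
  and restrict_dual_lact: "zext B (dual_lact UNIV a \<psi>) = dual_lact B a (zext B \<psi>)"
  by (auto simp: zext_def dual_ract_def dual_lact_def ideal_left ideal_right)

lemma lift_apply: "\<psi> \<in> dual smul UNIV \<Longrightarrow> lift m \<psi> = m (zext B \<psi>)"
  by (simp add: lift_def zext_def[of "dual smul UNIV"])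

text \<open>The representing element of \<open>lift m\<close> must lie in the ideal: otherwise some
  functional vanishing on the ideal is nonzero at it, although \<open>lift m\<close> sees only
  restrictions. Extension then reaches all functionals on the ideal.\<close>

lemma dual_ract_represented_ideal:
  assumes m: "m \<in> bidual smul B"
  obtains y where "y \<in> B" "\<And>\<psi>. \<psi> \<in> dual smul B \<Longrightarrow> m (dual_ract B \<psi> a) = \<psi> y"
proof -
  obtain y where "\<And>\<psi>. \<psi> \<in> dual smul UNIV \<Longrightarrow> lift m (dual_ract UNIV \<psi> a) = \<psi> y"
    using dual_ract_represented[OF lift_in_bidual[OF m]] by blast
  then have y: "m (dual_ract B (zext B \<psi>) a) = \<psi> y" if "\<psi> \<in> dual smul UNIV" for \<psi>
    using that whole.dual_ract_in_dual[OF that] by (metis lift_apply restrict_dual_ract)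
  have "y \<in> B"
  proof (rule ccontr)
    assume "y \<notin> B"
    then obtain \<psi> where \<psi>: "\<psi> \<in> dual smul UNIV" "zext B \<psi> = (\<lambda>x. 0)" "\<psi> y \<noteq> 0"
      by (rule separate_point)
    have "dual_ract B (\<lambda>x. 0) a = (\<lambda>x. 0 :: 'k)" by (auto simp: dual_ract_def zext_def)
    then show False using y[OF \<psi>(1)] \<psi>(2,3) bidual_zero[OF m] by simp
  qed
  moreover have "m (dual_ract B \<psi> a) = \<psi> y" if \<psi>: "\<psi> \<in> dual smul B" for \<psi>
  proof -
    obtain \<psi>' where \<psi>': "\<psi>' \<in> dual smul UNIV" "zext B \<psi>' = \<psi>" using dual_extend[OF \<psi>] .
    then show ?thesis using y[OF \<psi>'(1)] \<open>y \<in> B\<close> by (auto simp: zext_def)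
  qed
  ultimately show thesis using that by blast
qed

text \<open>If \<open>y\<close> in the ideal represents \<open>a m\<close>, then \<open>a\<close>
  acting on \<open>m \<cdot> \<phi>\<close> equals \<open>y \<cdot> \<phi>\<close>, and both sides
  are the value of \<open>\<phi> \<cdot> n\<close> at \<open>y\<close>.\<close>

lemma lact_ract_swap:
  assumes m: "m \<in> bidual smul B" and n: "n \<in> bidual smul B" and \<phi>: "\<phi> \<in> dual smul B"
  shows "n (dual_lact B a (bidual_lact B m \<phi>)) = m (dual_ract B (bidual_ract B \<phi> n) a)"
proof -
  obtain y where y: "y \<in> B" "\<And>\<psi>. \<psi> \<in> dual smul B \<Longrightarrow> m (dual_ract B \<psi> a) = \<psi> y"
    using dual_ract_represented_ideal[OF m] by blast
  have "dual_ract B \<phi> (x * a) = dual_ract B (dual_ract B \<phi> x) a" if "x \<in> B" for x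
    using that by (auto simp: dual_ract_def zext_def ideal_left mult.assoc)
  then have "dual_lact B a (bidual_lact B m \<phi>) = dual_lact B y \<phi>"
    using y dual_ract_in_dual[OF \<phi>]
    by (auto simp: dual_lact_def bidual_lact_def zext_def ideal_right dual_ract_def[of B \<phi>])
  then show ?thesis
    using y bidual_ract_in_dual[OF n \<phi>] by (simp add: bidual_ract_def zext_def)
qed

text \<open>With \<open>z\<close> representing \<open>m a\<close>, both sides equal the value of
  \<open>\<phi> \<cdot> n\<close> at \<open>z\<close>.\<close>

lemma dual_lact_arens_commuting:
  assumes \<phi>: "\<phi> \<in> dual smul UNIV"
  shows "dual_lact UNIV a \<phi> \<in> arens_commuting"
  unfolding arens_commuting_def
proof (intro CollectI conjI ballI)
  show "dual_lact UNIV a \<phi> \<in> dual smul UNIV" by (rule whole.dual_lact_in_dual[OF \<phi>])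
  fix m n assume m: "m \<in> bidual smul UNIV" and n: "n \<in> bidual smul UNIV"
  obtain z where z: "\<And>\<psi>. \<psi> \<in> dual smul UNIV \<Longrightarrow> m (dual_lact UNIV a \<psi>) = \<psi> z"
    using dual_lact_represented[OF m] by blast
  have "dual_ract UNIV (dual_lact UNIV a \<phi>) b = dual_lact UNIV a (dual_ract UNIV \<phi> b)"
    "dual_lact UNIV b (dual_lact UNIV a \<phi>) = dual_lact UNIV (b * a) \<phi>" for b
    by (auto simp: dual_ract_def dual_lact_def zext_def mult.assoc)
  then have "bidual_lact UNIV m (dual_lact UNIV a \<phi>) = dual_lact UNIV z \<phi>"
    and "bidual_ract UNIV (dual_lact UNIV a \<phi>) n = dual_lact UNIV a (bidual_ract UNIV \<phi> n)"
    using z[OF whole.dual_ract_in_dual[OF \<phi>]]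
    by (auto simp: bidual_lact_def bidual_ract_def zext_def dual_lact_def[of UNIV z] dual_ract_def[of UNIV \<phi>]
        dual_lact_def[of UNIV a "\<lambda>x. _ x"])
  then show "n (bidual_lact UNIV m (dual_lact UNIV a \<phi>)) = m (bidual_ract UNIV (dual_lact UNIV a \<phi>) n)"
    using z[OF whole.bidual_ract_in_dual[OF n \<phi>]] by (simp add: bidual_ract_def zext_def)
qed

text \<open>With \<open>y\<close> representing \<open>a n\<close>, both sides equal the value of
  \<open>m \<cdot> \<phi>\<close> at \<open>y\<close>.\<close>

lemma dual_ract_arens_commuting:
  assumes \<phi>: "\<phi> \<in> dual smul UNIV"
  shows "dual_ract UNIV \<phi> a \<in> arens_commuting"
  unfolding arens_commuting_def
proof (intro CollectI conjI ballI)
  show "dual_ract UNIV \<phi> a \<in> dual smul UNIV" by (rule whole.dual_ract_in_dual[OF \<phi>])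
  fix m n assume m: "m \<in> bidual smul UNIV" and n: "n \<in> bidual smul UNIV"
  obtain y where y: "\<And>\<psi>. \<psi> \<in> dual smul UNIV \<Longrightarrow> n (dual_ract UNIV \<psi> a) = \<psi> y"
    using dual_ract_represented[OF n] by blast
  have "dual_lact UNIV b (dual_ract UNIV \<phi> a) = dual_ract UNIV (dual_lact UNIV b \<phi>) a"
    "dual_ract UNIV (dual_ract UNIV \<phi> a) b = dual_ract UNIV \<phi> (a * b)" for b
    by (auto simp: dual_ract_def dual_lact_def zext_def mult.assoc)
  then have "bidual_ract UNIV (dual_ract UNIV \<phi> a) n = dual_ract UNIV \<phi> y"
    and "bidual_lact UNIV m (dual_ract UNIV \<phi> a) = dual_ract UNIV (bidual_lact UNIV m \<phi>) a"
    using y[OF whole.dual_lact_in_dual[OF \<phi>]]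
    by (auto simp: bidual_lact_def bidual_ract_def zext_def dual_ract_def[of UNIV \<phi> y] dual_lact_def[of UNIV _ \<phi>]
        dual_ract_def[of UNIV "\<lambda>x. _ x" a])
  then show "n (bidual_lact UNIV m (dual_ract UNIV \<phi> a)) = m (bidual_ract UNIV (dual_ract UNIV \<phi> a) n)"
    using y[OF whole.bidual_lact_in_dual[OF m \<phi>]] by (simp add: bidual_lact_def zext_def)
qed

section \<open>The annihilator of the weakly almost periodic functionals\<close>

text \<open>
  Up to a scalar, \<open>\<psi>\<close> is the pointwise limit of \<open>e\<^sub>\<alpha> \<cdot> \<psi>\<close>, and weak compactness forces this limit
  into the weakly closed kernel of \<open>r\<close>.
\<close>

lemma annihilates_WAP:
  assumes \<psi>: "\<psi> \<in> WAP smul UNIV" and r: "r \<in> bidual smul UNIV"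
    and vanish: "\<And>a. r (dual_lact UNIV a \<psi>) = 0"
  shows "r \<psi> = 0"
proof (rule ccontr)
  assume nz: "r \<psi> \<noteq> 0"
  let ?D = "dual smul UNIV" and ?M = "bidual smul UNIV"
  define \<sigma> where "\<sigma> = weak_topology ?D ?M"
  define T where "T = (\<lambda>a. dual_lact UNIV a \<psi>) ` {a. norm a \<le> 1}"
  define K where "K = \<sigma> closure_of T"
  have \<psi>D: "\<psi> \<in> ?D" and cpt: "compactin \<sigma> K"
    using \<psi> by (auto simp: WAP_def weakly_compact_into_dual_def Let_def \<sigma>_def K_def T_def)
  have top: "topspace \<sigma> = ?D"
    unfolding \<sigma>_def using r by (intro topspace_weak_topology) auto
  have "T \<subseteq> {\<rho> \<in> ?D. r \<rho> = 0}"
    using vanish whole.dual_lact_in_dual[OF \<psi>D] by (auto simp: T_def)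
  then have K: "K \<subseteq> {\<rho> \<in> ?D. r \<rho> = 0}"
    unfolding K_def by (rule closure_of_minimal) (simp add: \<sigma>_def closedin_weak_topology[OF r])
  have TK: "T \<subseteq> K"
    unfolding K_def by (rule closure_of_subset) (auto simp: top T_def whole.dual_lact_in_dual[OF \<psi>D])
  obtain C where C: "C > 0" "eventually (\<lambda>i. norm (e i) \<le> C) F" by (rule eventually_bounded)
  \<comment> \<open>Rescaling puts the approximate identity eventually into the unit ball, at the
    price of the factor \<open>1 / C\<close> in the limit.\<close>
  define x where "x i = (1 / C) *\<^sub>R e i" for i
  have xK: "eventually (\<lambda>i. dual_lact UNIV (x i) \<psi> \<in> K) F"
    using C(2)
  proof eventually_elim
    case (elim i)
    then show ?case using TK C(1) by (auto simp: T_def x_def intro!: subsetD[OF TK])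
  qed
  have lim: "((\<lambda>i. dual_lact UNIV (x i) \<psi> a) \<longlongrightarrow> of_real (1 / C) * \<psi> a) F" for a
  proof -
    have "((\<lambda>i. \<psi> (a * e i)) \<longlongrightarrow> \<psi> a) F"
      by (rule tendsto_dual[OF \<psi>D tendsto_right_unit])
    moreover have "dual_lact UNIV (x i) \<psi> a = of_real (1 / C) * \<psi> (a * e i)" for i
      using whole.dual_scale[OF \<psi>D, of "a * e i" "of_real (1 / C)", unfolded smul_of_real]
      by (simp add: dual_lact_def zext_def x_def)
    ultimately show ?thesis
      using tendsto_mult_left[of "\<lambda>i. \<psi> (a * e i)" "\<psi> a" F "of_real (1 / C)"] by presburger
  qed
  \<comment> \<open>Compactness is used through covers: no point of \<open>K\<close> is the
    pointwise limit, so each has a neighbourhood that the net eventually avoids. A finite subcover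
    would make the net eventually avoid all of \<open>K\<close>.\<close>
  let ?\<U> = "{U. openin \<sigma> U \<and> eventually (\<lambda>i. dual_lact UNIV (x i) \<psi> \<notin> U) F}"
  have "K \<subseteq> \<Union> ?\<U>"
  proof
    fix \<kappa> assume "\<kappa> \<in> K"
    then have \<kappa>: "\<kappa> \<in> ?D" "r \<kappa> = 0" using K by auto
    have "r (\<lambda>a. of_real (1 / C) * \<psi> a) \<noteq> 0"
      using nz C(1) whole.bidual_smult[OF r \<psi>D, of "of_real (1 / C)"] by simp
    then have "\<kappa> \<noteq> (\<lambda>a. of_real (1 / C) * \<psi> a)" using \<kappa>(2) by auto
    then obtain a where "\<kappa> a \<noteq> of_real (1 / C) * \<psi> a" by blast
    then obtain U W where UW: "open U" "open W" "\<kappa> a \<in> U" "of_real (1 / C) * \<psi> a \<in> W" "U \<inter> W = {}"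
      using hausdorff by metis
    have "openin \<sigma> {\<rho> \<in> ?D. canonical smul UNIV a \<rho> \<in> U}"
      unfolding \<sigma>_def by (rule openin_weak_topology[OF whole.canonical_in_bidual UW(1)])
    moreover have "{\<rho> \<in> ?D. canonical smul UNIV a \<rho> \<in> U} = {\<rho> \<in> ?D. \<rho> a \<in> U}"
      by (auto simp: canonical_def zext_def)
    moreover have "eventually (\<lambda>i. dual_lact UNIV (x i) \<psi> \<notin> {\<rho> \<in> ?D. \<rho> a \<in> U}) F"
      using topological_tendstoD[OF lim UW(2,4)]
      by eventually_elim (use UW(5) in auto)
    ultimately show "\<kappa> \<in> \<Union> ?\<U>" using \<kappa>(1) UW(3) by auto
  qed
  then obtain \<F> where \<F>: "finite \<F>" "\<F> \<subseteq> ?\<U>" "K \<subseteq> \<Union> \<F>"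
    using compactinD[OF cpt, of ?\<U>] by auto
  then have "eventually (\<lambda>i. \<forall>U\<in>\<F>. dual_lact UNIV (x i) \<psi> \<notin> U) F"
    by (intro eventually_ball_finite) auto
  with xK have "eventually (\<lambda>i. False) F" by eventually_elim (use \<F>(3) in auto)
  then show False using filter_nontrivial by (simp add: trivial_limit_def)
qed

lemma WAP_restrict_subset_dual: "WAP_restrict smul B \<subseteq> dual smul B"
  using restrict_in_dual by (auto simp: WAP_restrict_def WAP_def)

lemma dual_closure_WAP_restrict:
  assumes \<psi>: "\<psi> \<in> dual_closure smul B (WAP_restrict smul B)" and r: "r \<in> WAP_perp smul B"
  shows "r \<psi> = 0"
proof -
  have rM: "r \<in> bidual smul B" and r0: "\<And>\<eta>. \<eta> \<in> WAP_restrict smul B \<Longrightarrow> r \<eta> = 0"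
    using r by (auto simp: WAP_perp_def)
  have \<psi>D: "\<psi> \<in> dual smul B" using \<psi> by (simp add: dual_closure_def)
  obtain C where C: "C \<ge> 0" "\<And>\<phi>. \<phi> \<in> dual smul B \<Longrightarrow> norm (r \<phi>) \<le> C * onorm \<phi>"
    using bidual_bounded[OF rM] by blast
  have "norm (r \<psi>) \<le> 0 + \<epsilon>" if \<epsilon>: "\<epsilon> > 0" for \<epsilon>
  proof -
    \<comment> \<open>The denominator is \<open>C + 1\<close> because \<open>C\<close> may be
      \<open>0\<close>.\<close>
    obtain \<eta> where \<eta>: "\<eta> \<in> WAP_restrict smul B" "onorm (\<lambda>x. \<psi> x - \<eta> x) < \<epsilon> / (C + 1)"
      using \<psi> \<epsilon> C(1) by (auto simp: dual_closure_def dest!: spec[of _ "\<epsilon> / (C + 1)"])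
    have \<eta>D: "\<eta> \<in> dual smul B" using \<eta>(1) WAP_restrict_subset_dual by blast
    have "norm (r \<psi>) = norm (r (\<lambda>x. \<psi> x - \<eta> x))" using bidual_diff[OF rM \<psi>D \<eta>D] r0[OF \<eta>(1)] by simp
    also have "\<dots> \<le> C * onorm (\<lambda>x. \<psi> x - \<eta> x)" by (rule C(2)[OF dual_minus[OF \<psi>D \<eta>D]])
    also have "\<dots> \<le> (C + 1) * (\<epsilon> / (C + 1))"
      using \<eta>(2) C(1) onorm_dual_nonneg[OF dual_minus[OF \<psi>D \<eta>D]] by (intro mult_mono) auto
    finally show ?thesis using C(1) by simp
  qed
  then have "norm (r \<psi>) \<le> 0" by (rule field_le_epsilon)
  then show ?thesis by simp
qed

text \<open>After extending \<phi> to the algebra, the functionals \<open>\<phi> \<cdot> x\<close>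
  and \<open>x \<cdot> \<phi>\<close> are restrictions of weakly almost periodic ones, so
  \<open>r\<close> annihilates them.\<close>

lemma WAP_perp_lact:
  assumes r: "r \<in> WAP_perp smul B" and \<phi>: "\<phi> \<in> dual smul B"
  shows "bidual_lact B r \<phi> = (\<lambda>x. 0)" and "bidual_ract B \<phi> r = (\<lambda>x. 0)"
proof -
  obtain \<phi>' where \<phi>': "\<phi>' \<in> dual smul UNIV" "zext B \<phi>' = \<phi>" using dual_extend[OF \<phi>] .
  have "dual_ract B \<phi> x \<in> WAP_restrict smul B" "dual_lact B x \<phi> \<in> WAP_restrict smul B" for x
    using arens_commuting_subset_WAP dual_ract_arens_commuting[OF \<phi>'(1), of x]
      dual_lact_arens_commuting[OF \<phi>'(1), of x]
    unfolding WAP_restrict_def \<phi>'(2)[symmetric] restrict_dual_ract[symmetric] restrict_dual_lact[symmetric]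
    by blast+
  then show "bidual_lact B r \<phi> = (\<lambda>x. 0)" and "bidual_ract B \<phi> r = (\<lambda>x. 0)"
    using r by (auto simp: WAP_perp_def bidual_lact_def bidual_ract_def zext_def)
qed

text \<open>By \<open>annihilates_WAP\<close> for \<open>lift r\<close>, vanishing on the
  functionals \<open>a \<cdot> \<psi>\<close> already forces vanishing on all of
  \<open>WAP_restrict\<close>.\<close>

lemma in_WAP_perpI:
  assumes r: "r \<in> bidual smul B"
    and vanish: "\<And>a \<psi>. \<psi> \<in> dual smul UNIV \<Longrightarrow> r (zext B (dual_lact UNIV a \<psi>)) = 0"
  shows "r \<in> WAP_perp smul B"
proof -
  have "r (zext B \<psi>) = 0" if \<psi>: "\<psi> \<in> WAP smul UNIV" for \<psi>
  proof -
    have \<psi>D: "\<psi> \<in> dual smul UNIV" using \<psi> by (simp add: WAP_def)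
    have "lift r \<psi> = 0"
      by (rule annihilates_WAP[OF \<psi> lift_in_bidual[OF r]])
        (simp add: lift_apply vanish \<psi>D whole.dual_lact_in_dual)
    then show ?thesis by (simp add: lift_apply \<psi>D)
  qed
  then show ?thesis using r by (auto simp: WAP_perp_def WAP_restrict_def)
qed

lemma dual_closure_mono: "S \<subseteq> T \<Longrightarrow> dual_closure smul B S \<subseteq> dual_closure smul B T"
  unfolding dual_closure_def by blast

text \<open>Separation is carried out from the restrictions of \<open>arens_commuting\<close>, which
  form a subspace inside \<open>WAP_restrict\<close>. They include all restricted
  \<open>a \<cdot> \<psi>\<close>, so the separating \<open>r\<close> lies in
  \<open>WAP_perp\<close>.\<close>

lemma dual_closure_WAP_restrictI:
  assumes \<psi>: "\<psi> \<in> dual smul B" and vanish: "\<And>r. r \<in> WAP_perp smul B \<Longrightarrow> r \<psi> = 0"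
  shows "\<psi> \<in> dual_closure smul B (WAP_restrict smul B)"
proof (rule ccontr)
  assume nin: "\<psi> \<notin> dual_closure smul B (WAP_restrict smul B)"
  let ?S = "zext B ` arens_commuting"
  have sub: "?S \<subseteq> WAP_restrict smul B"
    using arens_commuting_subset_WAP by (auto simp: WAP_restrict_def)
  have "fun_space.subspace ?S"
  proof -
    have "zext B \<phi> + zext B \<psi> = zext B (\<phi> + \<psi>)" "(\<lambda>x. c * zext B \<phi> x) = zext B (\<lambda>x. c * \<phi> x)"
        "zext B (0 :: 'a \<Rightarrow> 'k) = 0" for \<phi> \<psi> :: "'a \<Rightarrow> 'k" and c
      by (auto simp: zext_def fun_eq_iff)
    then show ?thesis
      using subspace_arens_commuting unfolding fun_space.subspace_def
      by (auto simp: image_iff)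
  qed
  moreover have "?S \<subseteq> dual smul B" using sub WAP_restrict_subset_dual by blast
  moreover have "\<psi> \<notin> dual_closure smul B ?S" using nin dual_closure_mono[OF sub] by blast
  ultimately obtain r where r: "r \<in> bidual smul B" "\<And>\<eta>. \<eta> \<in> ?S \<Longrightarrow> r \<eta> = 0" "r \<psi> \<noteq> 0"
    using separate_dual[OF _ _ \<psi>] by blast
  have "r \<in> WAP_perp smul B"
    using dual_lact_arens_commuting by (intro in_WAP_perpI r) auto
  then show False using vanish r(3) by blast
qed

text \<open>The usual approximation argument: the maps \<open>T i\<close> are eventually uniformly
  bounded because the net is. An abstract \<open>T\<close> covers the left and the right action at
  once.\<close>

lemma tendsto_dual_closure:
  assumes \<psi>: "\<psi> \<in> dual_closure smul B S" and S: "S \<subseteq> dual smul B"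
    and T_dual: "\<And>i \<phi>. \<phi> \<in> dual smul B \<Longrightarrow> T i \<phi> \<in> dual smul B"
    and T_diff: "\<And>i \<phi> \<eta>. T i (\<lambda>x. \<phi> x - \<eta> x) = (\<lambda>x. T i \<phi> x - T i \<eta> x)"
    and T_onorm: "\<And>i \<phi>. \<phi> \<in> dual smul B \<Longrightarrow> onorm (T i \<phi>) \<le> onorm \<phi> * norm (e i)"
    and n: "n \<in> bidual smul B"
    and lim: "\<And>\<eta>. \<eta> \<in> S \<Longrightarrow> ((\<lambda>i. n (T i \<eta>)) \<longlongrightarrow> n \<eta>) F"
  shows "((\<lambda>i. n (T i \<psi>)) \<longlongrightarrow> n \<psi>) F"
proof (rule tendstoI)
  fix \<epsilon> :: real assume \<epsilon>: "\<epsilon> > 0"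
  have \<psi>D: "\<psi> \<in> dual smul B" using \<psi> by (simp add: dual_closure_def)
  obtain C where C: "C \<ge> 0" "\<And>\<phi>. \<phi> \<in> dual smul B \<Longrightarrow> norm (n \<phi>) \<le> C * onorm \<phi>"
    using bidual_bounded[OF n] by blast
  obtain K where K: "K > 0" "eventually (\<lambda>i. norm (e i) \<le> K) F" by (rule eventually_bounded)
  \<comment> \<open>The factor \<open>K + 1\<close> collects the errors before and after applying
    \<open>T i\<close>; \<open>C + 1\<close> avoids division by \<open>0\<close>.\<close>
  define \<delta> where "\<delta> = \<epsilon> / 2 / ((C + 1) * (K + 1))"
  have \<delta>: "\<delta> > 0" using \<epsilon> C(1) K(1) by (simp add: \<delta>_def)
  then obtain \<eta> where \<eta>: "\<eta> \<in> S" "onorm (\<lambda>x. \<psi> x - \<eta> x) < \<delta>"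
    using \<psi> by (auto simp: dual_closure_def)
  have \<eta>D: "\<eta> \<in> dual smul B" using \<eta>(1) S by blast
  let ?d = "\<lambda>x. \<psi> x - \<eta> x"
  have d: "?d \<in> dual smul B" by (rule dual_minus[OF \<psi>D \<eta>D])
  have "eventually (\<lambda>i. dist (n (T i \<eta>)) (n \<eta>) < \<epsilon> / 2) F" using tendstoD[OF lim[OF \<eta>(1)], of "\<epsilon> / 2"] \<epsilon> by simp
  then show "eventually (\<lambda>i. dist (n (T i \<psi>)) (n \<psi>) < \<epsilon>) F"
    using K(2)
  proof eventually_elim
    case (elim i)
    have "n (T i \<psi>) - n \<psi> = n (T i ?d) + (n (T i \<eta>) - n \<eta>) - n ?d"
      using bidual_diff[OF n T_dual[OF \<psi>D] T_dual[OF \<eta>D], of i i] bidual_diff[OF n \<psi>D \<eta>D]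
      by (simp add: T_diff[of i \<psi> \<eta>])
    then have "norm (n (T i \<psi>) - n \<psi>) \<le> norm (n (T i ?d)) + norm (n (T i \<eta>) - n \<eta>) + norm (n ?d)"
      using norm_triangle_ineq4[of "n (T i ?d) + (n (T i \<eta>) - n \<eta>)" "n ?d"]
        norm_triangle_ineq[of "n (T i ?d)" "n (T i \<eta>) - n \<eta>"] by simp
    moreover have "norm (n (T i ?d)) \<le> C * (onorm ?d * K)"
    proof -
      have "onorm (T i ?d) \<le> onorm ?d * K"
        using T_onorm[OF d, of i] mult_left_mono[OF elim(2) onorm_dual_nonneg[OF d]] by simp
      then show ?thesis using C(2)[OF T_dual[OF d], of i] mult_left_mono[OF _ C(1)] by (meson order_trans)
    qed
    moreover have "norm (n ?d) \<le> C * onorm ?d" by (rule C(2)[OF d])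
    moreover have "C * (onorm ?d * K) + C * onorm ?d \<le> \<epsilon> / 2"
    proof -
      have "C * (onorm ?d * K) + C * onorm ?d = C * (K + 1) * onorm ?d" by (simp add: algebra_simps)
      also have "\<dots> \<le> (C + 1) * (K + 1) * \<delta>"
        using C(1) K(1) \<eta>(2) onorm_dual_nonneg[OF d] \<delta> by (intro mult_mono) auto
      also have "\<dots> = \<epsilon> / 2"
      proof -
        have "a * (\<epsilon> / 2 / a) = \<epsilon> / 2" if "a > 0" for a
          using that by simp
        from this[of "(C + 1) * (K + 1)"] show ?thesis using C(1) K(1) by (simp only: \<delta>_def) simp
      qed
      finally show ?thesis .
    qed
    ultimately show ?case using elim(1) by (simp add: dist_norm)
  qed
qed

lemma dual_lact_diff: "dual_lact B a (\<lambda>x. \<phi> x - \<eta> x) = (\<lambda>x. dual_lact B a \<phi> x - dual_lact B a \<eta> x)"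
  and dual_ract_diff: "dual_ract B (\<lambda>x. \<phi> x - \<eta> x) a = (\<lambda>x. dual_ract B \<phi> a x - dual_ract B \<eta> a x)"
  for \<phi> \<eta> :: "'a \<Rightarrow> 'k"
  by (auto simp: dual_lact_def dual_ract_def zext_def)

text \<open>The two limits have different sources. The left action absorbs \<open>e i\<close> into
  \<open>e i * a\<close>, a convergent argument of a functional; for the right action,
  \<open>z\<close> representing the product of \<open>lift n\<close> with \<open>a\<close> gives
  \<open>\<psi> (e i * z)\<close>.\<close>

lemma tendsto_unit_dual_lact:
  assumes \<psi>: "\<psi> \<in> dual smul UNIV" and n: "n \<in> bidual smul B" and \<eta>: "\<eta> = zext B (dual_lact UNIV a \<psi>)"
  shows "((\<lambda>i. n (dual_lact B (e i) \<eta>)) \<longlongrightarrow> n \<eta>) F"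
    and "((\<lambda>i. n (dual_ract B \<eta> (e i))) \<longlongrightarrow> n \<eta>) F"
proof -
  obtain z where z: "\<And>\<psi>. \<psi> \<in> dual smul UNIV \<Longrightarrow> lift n (dual_lact UNIV a \<psi>) = \<psi> z"
    using dual_lact_represented[OF lift_in_bidual[OF n]] by blast
  have lact: "n (zext B (dual_lact UNIV b \<rho>)) = lift n (dual_lact UNIV b \<rho>)" if "\<rho> \<in> dual smul UNIV" for b \<rho>
    by (simp add: lift_apply whole.dual_lact_in_dual[OF that])
  have n\<eta>: "n \<eta> = \<psi> z" using lact[OF \<psi>] z[OF \<psi>] by (simp add: \<eta>)
  have "dual_ract B \<eta> (e i) = zext B (dual_lact UNIV a (dual_ract UNIV \<psi> (e i)))" for i
    unfolding \<eta> restrict_dual_ract[symmetric]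
    by (auto simp: zext_def dual_lact_def dual_ract_def mult.assoc)
  then have "n (dual_ract B \<eta> (e i)) = \<psi> (e i * z)" for i
    using lact[OF whole.dual_ract_in_dual[OF \<psi>]] z[OF whole.dual_ract_in_dual[OF \<psi>]]
    by (simp add: dual_ract_def zext_def)
  then show "((\<lambda>i. n (dual_ract B \<eta> (e i))) \<longlongrightarrow> n \<eta>) F"
    using tendsto_dual[OF \<psi> tendsto_left_unit[of z]] by (simp add: n\<eta>)
  have "dual_lact B (e i) \<eta> = zext B (dual_lact UNIV (e i * a) \<psi>)" for i
    unfolding \<eta> restrict_dual_lact[symmetric]
    by (auto simp: zext_def dual_lact_def mult.assoc)
  then have "n (dual_lact B (e i) \<eta>) = bidual_ract UNIV \<psi> (lift n) (e i * a)" for i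
    using lact[OF \<psi>] by (simp add: bidual_ract_def zext_def)
  moreover have "n \<eta> = bidual_ract UNIV \<psi> (lift n) a"
    using lact[OF \<psi>] by (simp add: \<eta> bidual_ract_def zext_def)
  ultimately show "((\<lambda>i. n (dual_lact B (e i) \<eta>)) \<longlongrightarrow> n \<eta>) F"
    using tendsto_dual[OF whole.bidual_ract_in_dual[OF lift_in_bidual[OF n] \<psi>] tendsto_left_unit[of a]] by simp
qed

text \<open>For fixed \<psi> the functionals \<open>a \<cdot> \<psi>\<close> form a subspace. If an
  \<open>r\<close> vanishes on it, \<open>annihilates_WAP\<close> for \<open>lift r\<close> gives
  \<open>r (zext B \<psi>) = 0\<close>, so separation is impossible.\<close>

lemma WAP_restrict_closure:
  assumes \<psi>: "\<psi> \<in> WAP smul UNIV"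
  shows "zext B \<psi> \<in> dual_closure smul B (range (\<lambda>a. zext B (dual_lact UNIV a \<psi>)))"
    (is "_ \<in> dual_closure smul B ?S")
proof (rule ccontr)
  assume nin: "zext B \<psi> \<notin> dual_closure smul B ?S"
  have \<psi>D: "\<psi> \<in> dual smul UNIV" using \<psi> by (simp add: WAP_def)
  have "fun_space.subspace ?S"
    unfolding fun_space.subspace_def
  proof (intro conjI ballI allI)
    show "0 \<in> ?S"
      by (rule range_eqI[of _ _ 0])
        (use whole.dual_scale[OF \<psi>D, of 0 0] in \<open>auto simp: zext_def dual_lact_def\<close>)
    show "\<phi> + \<rho> \<in> ?S" if "\<phi> \<in> ?S" "\<rho> \<in> ?S" for \<phi> \<rho>
    proof -
      obtain a b where "\<phi> = zext B (dual_lact UNIV a \<psi>)" "\<rho> = zext B (dual_lact UNIV b \<psi>)"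
        using \<open>\<phi> \<in> ?S\<close> \<open>\<rho> \<in> ?S\<close> by blast
      then show ?thesis
        by (intro range_eqI[of _ _ "a + b"]) (auto simp: zext_def whole.dual_lact_add[OF \<psi>D])
    qed
    show "(\<lambda>x. c * \<phi> x) \<in> ?S" if "\<phi> \<in> ?S" for c \<phi>
    proof -
      obtain a where "\<phi> = zext B (dual_lact UNIV a \<psi>)" using \<open>\<phi> \<in> ?S\<close> by blast
      then show ?thesis
        by (intro range_eqI[of _ _ "smul c a"]) (auto simp: zext_def whole.dual_lact_smul[OF \<psi>D])
    qed
  qed
  moreover have "?S \<subseteq> dual smul B" using restrict_in_dual whole.dual_lact_in_dual[OF \<psi>D] by auto
  ultimately obtain r where r: "r \<in> bidual smul B" "\<And>\<eta>. \<eta> \<in> ?S \<Longrightarrow> r \<eta> = 0" "r (zext B \<psi>) \<noteq> 0"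
    using separate_dual[OF _ _ restrict_in_dual[OF \<psi>D] nin] by blast
  have "lift r \<psi> = 0"
    by (rule annihilates_WAP[OF \<psi> lift_in_bidual[OF r(1)]])
      (simp add: lift_apply r(2) whole.dual_lact_in_dual[OF \<psi>D])
  then show False using r(3) by (simp add: lift_apply \<psi>D)
qed

text \<open>Two passages to a norm closure: from the functionals \<open>a \<cdot> \<rho>\<close> to
  the restriction of \<rho> in \<open>WAP\<close>, and from there to the closure of
  \<open>WAP_restrict\<close>.\<close>

lemma tendsto_unit_WAP_closure:
  assumes \<psi>: "\<psi> \<in> dual_closure smul B (WAP_restrict smul B)" and n: "n \<in> bidual smul B"
  shows "((\<lambda>i. n (dual_lact B (e i) \<psi>)) \<longlongrightarrow> n \<psi>) F"
    and "((\<lambda>i. n (dual_ract B \<psi> (e i))) \<longlongrightarrow> n \<psi>) F"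
proof -
  have WAP: "((\<lambda>i. n (dual_lact B (e i) \<eta>)) \<longlongrightarrow> n \<eta>) F \<and> ((\<lambda>i. n (dual_ract B \<eta> (e i))) \<longlongrightarrow> n \<eta>) F"
    if "\<eta> \<in> WAP_restrict smul B" for \<eta>
  proof -
    obtain \<rho> where \<rho>: "\<rho> \<in> WAP smul UNIV" "\<eta> = zext B \<rho>" using \<open>\<eta> \<in> WAP_restrict smul B\<close> by (auto simp: WAP_restrict_def)
    then have \<rho>D: "\<rho> \<in> dual smul UNIV" by (simp add: WAP_def)
    have sub: "range (\<lambda>a. zext B (dual_lact UNIV a \<rho>)) \<subseteq> dual smul B"
      using restrict_in_dual whole.dual_lact_in_dual[OF \<rho>D] by auto
    show ?thesis
      unfolding \<rho>(2)
      by (intro conjI tendsto_dual_closure[OF WAP_restrict_closure[OF \<rho>(1)] sub])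
        (auto simp: dual_lact_in_dual dual_ract_in_dual onorm_dual_lact onorm_dual_ract n
          dual_lact_diff dual_ract_diff intro: tendsto_unit_dual_lact[OF \<rho>D n])
  qed
  show "((\<lambda>i. n (dual_lact B (e i) \<psi>)) \<longlongrightarrow> n \<psi>) F"
    by (rule tendsto_dual_closure[OF \<psi> WAP_restrict_subset_dual])
      (auto simp: dual_lact_in_dual onorm_dual_lact n dual_lact_diff WAP)
  show "((\<lambda>i. n (dual_ract B \<psi> (e i))) \<longlongrightarrow> n \<psi>) F"
    by (rule tendsto_dual_closure[OF \<psi> WAP_restrict_subset_dual])
      (auto simp: dual_ract_in_dual onorm_dual_ract n dual_ract_diff WAP)
qed

section \<open>The four conditions compared\<close>

lemma arens1_eq_arens2_iff: "arens1 smul B m n = arens2 smul B m n \<longleftrightarrow>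
    (\<forall>\<phi>\<in>dual smul B. m (bidual_lact B n \<phi>) = n (bidual_ract B \<phi> m))"
  by (auto simp: arens1_def arens2_def zext_def fun_eq_iff)

text \<open>The common middle term: each of the four conditions is shown equivalent to this
  one.\<close>

definition perp_annihilates :: bool where
  "perp_annihilates \<longleftrightarrow> (\<forall>r\<in>WAP_perp smul B. \<forall>m\<in>bidual smul B. \<forall>\<phi>\<in>dual smul B.
     r (bidual_lact B m \<phi>) = 0 \<and> r (bidual_ract B \<phi> m) = 0)"

lemma WAP_perp_in_bidual: "r \<in> WAP_perp smul B \<Longrightarrow> r \<in> bidual smul B"
  by (simp add: WAP_perp_def)

text \<open>In each centre condition one of the two products vanishes by
  \<open>WAP_perp_lact\<close>, so the condition says that the other vanishes too.\<close>

lemma perp_centres_iff: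
  "WAP_perp smul B \<subseteq> topological_centre1 smul B \<inter> topological_centre2 smul B \<longleftrightarrow> perp_annihilates"
  by (auto simp: perp_annihilates_def topological_centre1_def topological_centre2_def subset_iff
      arens1_eq_arens2_iff WAP_perp_lact WAP_perp_in_bidual bidual_zero)

text \<open>By Hahn-Banach, a functional lies in the closure of \<open>WAP_restrict\<close> exactly
  when every member of \<open>WAP_perp\<close> annihilates it.\<close>

lemma weak_Riesz_iff: "weak_Riesz_ideal smul B \<longleftrightarrow> perp_annihilates"
  unfolding weak_Riesz_ideal_def perp_annihilates_def
  using dual_closure_WAP_restrict dual_closure_WAP_restrictI bidual_lact_in_dual bidual_ract_in_dual
  by blast

lemma arens1_eq_zero_iff:
    "arens1 smul B m n = (\<lambda>_. 0) \<longleftrightarrow> (\<forall>\<phi>\<in>dual smul B. m (bidual_lact B n \<phi>) = 0)"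
  and arens2_eq_zero_iff:
    "arens2 smul B m n = (\<lambda>_. 0) \<longleftrightarrow> (\<forall>\<phi>\<in>dual smul B. n (bidual_ract B \<phi> m) = 0)"
  by (auto simp: arens1_def arens2_def zext_def fun_eq_iff)

lemma perp_products_iff:
  "{arens1 smul B r m |r m. r \<in> WAP_perp smul B \<and> m \<in> bidual smul B} = {\<lambda>_. 0} \<and>
   {arens2 smul B m r |m r. m \<in> bidual smul B \<and> r \<in> WAP_perp smul B} = {\<lambda>_. 0} \<longleftrightarrow> perp_annihilates"
proof -
  \<comment> \<open>The zero functional makes both sets of products nonempty, so being equal to the
    singleton means only that all products vanish.\<close>
  obtain z where z: "z \<in> WAP_perp smul B" "z \<in> bidual smul B"
    using zero_in_bidual by (simp add: WAP_perp_def that[of "\<lambda>\<phi>. 0"])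
  have "{arens1 smul B r m |r m. r \<in> WAP_perp smul B \<and> m \<in> bidual smul B} = {\<lambda>_. 0} \<longleftrightarrow>
      (\<forall>r m. r \<in> WAP_perp smul B \<and> m \<in> bidual smul B \<longrightarrow> arens1 smul B r m = (\<lambda>_. 0))"
    by (rule setcompr_eq_singleton_iff) (use z in blast)
  moreover have "{arens2 smul B m r |m r. m \<in> bidual smul B \<and> r \<in> WAP_perp smul B} = {\<lambda>_. 0} \<longleftrightarrow>
      (\<forall>m r. m \<in> bidual smul B \<and> r \<in> WAP_perp smul B \<longrightarrow> arens2 smul B m r = (\<lambda>_. 0))"
    by (rule setcompr_eq_singleton_iff) (use z in blast)
  ultimately show ?thesis
    unfolding perp_annihilates_def arens1_eq_zero_iff arens2_eq_zero_iff by blast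
qed

lemma arens_regular_iff: "arens_regular smul B \<longleftrightarrow> perp_annihilates"
proof
  assume "arens_regular smul B"
  then have eq: "m (bidual_lact B n \<phi>) = n (bidual_ract B \<phi> m)"
    if "m \<in> bidual smul B" "n \<in> bidual smul B" "\<phi> \<in> dual smul B" for m n \<phi>
    using that by (simp add: arens_regular_def arens1_eq_arens2_iff)
  show perp_annihilates
    unfolding perp_annihilates_def
  proof (intro ballI conjI)
    fix r m \<phi> assume r: "r \<in> WAP_perp smul B" and m: "m \<in> bidual smul B" and \<phi>: "\<phi> \<in> dual smul B"
    note rM = WAP_perp_in_bidual[OF r]
    show "r (bidual_lact B m \<phi>) = 0"
      using eq[OF rM m \<phi>] WAP_perp_lact[OF r \<phi>] bidual_zero[OF m] by simp
    show "r (bidual_ract B \<phi> m) = 0"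
      using eq[OF m rM \<phi>] WAP_perp_lact[OF r \<phi>] bidual_zero[OF m] by simp
  qed
next
  assume "perp_annihilates"
  then have closure: "bidual_lact B m \<phi> \<in> dual_closure smul B (WAP_restrict smul B)"
    "bidual_ract B \<phi> m \<in> dual_closure smul B (WAP_restrict smul B)"
    if "m \<in> bidual smul B" "\<phi> \<in> dual smul B" for m \<phi>
    using that by (auto simp flip: weak_Riesz_iff simp: weak_Riesz_ideal_def)
  show "arens_regular smul B"
    unfolding arens_regular_def arens1_eq_arens2_iff
  proof (intro ballI)
    fix m n \<phi> assume m: "m \<in> bidual smul B" and n: "n \<in> bidual smul B" and \<phi>: "\<phi> \<in> dual smul B"
    have "((\<lambda>i. m (dual_lact B (e i) (bidual_lact B n \<phi>))) \<longlongrightarrow> m (bidual_lact B n \<phi>)) F"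
      by (rule tendsto_unit_WAP_closure(1)[OF closure(1)[OF n \<phi>] m])
    moreover have "((\<lambda>i. n (dual_ract B (bidual_ract B \<phi> m) (e i))) \<longlongrightarrow> n (bidual_ract B \<phi> m)) F"
      by (rule tendsto_unit_WAP_closure(2)[OF closure(2)[OF m \<phi>] n])
    \<comment> \<open>By \<open>lact_ract_swap\<close> the two nets agree term by term, so their
      limits coincide.\<close>
    ultimately show "m (bidual_lact B n \<phi>) = n (bidual_ract B \<phi> m)"
      unfolding lact_ract_swap[OF n m \<phi>] using filter_nontrivial by (rule tendsto_unique[rotated])
  qed
qed

end

theorem theorem5p2:
  fixes smul :: "'k::{real_normed_field,euclidean_space} \<Rightarrow> 'a::{real_normed_algebra,banach} \<Rightarrow> 'a"
    and F :: "'i filter" and e :: "'i \<Rightarrow> 'a" and J :: "'a set"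
  assumes "banach_algebra smul"
    and "ideal_in_bidual smul UNIV"
    and "bounded_approximate_identity F e"
    and "closed_ideal smul J"
  shows "(arens_regular smul J \<longleftrightarrow>
            WAP_perp smul J \<subseteq> topological_centre1 smul J \<inter> topological_centre2 smul J) \<and>
         (arens_regular smul J \<longleftrightarrow> weak_Riesz_ideal smul J) \<and>
         (arens_regular smul J \<longleftrightarrow>
            {arens1 smul J r m |r m. r \<in> WAP_perp smul J \<and> m \<in> bidual smul J} = {\<lambda>_. 0} \<and>
            {arens2 smul J m r |m r. m \<in> bidual smul J \<and> r \<in> WAP_perp smul J} = {\<lambda>_. 0})"
proof -
  interpret banach_algebra smul by fact
  interpret ideal_in_bidual_setting smul J F e by unfold_locales fact+
  show ?thesis
    unfolding arens_regular_iff perp_centres_iff weak_Riesz_iff perp_products_iff by simp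
qed

end
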